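(* Let $\bar{\mathbf{G}}$ and $\mathbf{G}$ be two projectively related sprays on a manifold, with projective factor $P$, i.e. $\bar G^i=G^i+Py^i$, where $P$ is positively homogeneous of degree one in $y$. Let $\bar R^i_{\ k},\bar{Ric}$ and $R^i_{\ k},Ric$ denote the Riemann and Ricci curvatures of $\bar{\mathbf{G}}$ and $\mathbf{G}$ respectively. Then: (i) $\bar R^i_{\ k}=R^i_{\ k}$ if and only if $P$ is a Funk function of $\mathbf{G}$. (ii) $\bar{Ric}=Ric$ if and only if $P$ is a weak Funk function of $\mathbf{G}$. (iii) If $\mathbf{G}$ is of isotropic curvature, then $\bar{\mathbf{G}}$ is of isotropic curvature if and only if $P$ is a Hamel function of $\mathbf{G}$.
   Context: A spray on a manifold $M$ is a smooth vector field on a conical region of $TM\setminus\{0\}$ (a region closed under $y\mapsto\lambda y$ for $\lambda>0$), locally $\mathbf{G}=y^i\frac{\partial}{\partial x^i}-2G^i\frac{\partial}{\partial y^i}$ with $G^i=G^i(x,y)$ positively homogeneous of degree two in $y$. Two sprays are projectively related if their geodesics (projections to $M$ of integral curves) coincide as point sets, equivalently $\bar G^i=G^i+Py^i$ for some function $P$ positively homogeneous of degree one in $y$, called the projective factor. Put $\partial_k=\partial/\partial x^k$, $\dot\partial_k=\partial/\partial y^k$, $G^r_i=\dot\partial_iG^r$, $G^r_{ij}=\dot\partial_j\dot\partial_iG^r$, $\delta_i=\partial_i-G^r_i\dot\partial_r$. For a function $f(x,y)$: $f_{.i}=\dot\partial_if$, $f_{;i}=\delta_if$, $f_{;0}=f_{;i}y^i$,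 $f_{.i;j}=\delta_jf_{.i}-f_{.r}G^r_{ij}$, $f_{.i;0}=f_{.i;j}y^j$ (derivatives with respect to the Berwald connection of $\mathbf{G}$). The Riemann curvature of $\mathbf{G}$ is $R^i_{\ k}=2\partial_kG^i-y^j\partial_j\dot\partial_kG^i+2G^j\dot\partial_j\dot\partial_kG^i-(\dot\partial_jG^i)(\dot\partial_kG^j)$, and the Ricci curvature is $Ric=R^i_{\ i}$. The spray is of isotropic curvature if $R^i_{\ k}=R\delta^i_k-\tau_ky^i$ for some homogeneous functions $R(x,y),\tau_k(x,y)$ with $R_{.i}=2\tau_i$. A function $P$, positively homogeneous of degree one in $y$, is called a Hamel function of $\mathbf{G}$ if $P_{;k}=P_{.k;0}$, a Funk function of $\mathbf{G}$ if $P_{;k}=PP_{.k}$, and a weak Funk function of $\mathbf{G}$ if $P_{;0}=P^2$.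
   Formalization: Parts (i) and (ii) are stated for manifolds of dimension at least two; in dimension one every spray has zero Riemann curvature, so they fail there (e.g. G = 0, P = y on y > 0). Part (iii) is stated in every dimension. *)

theory Defs
  imports "HOL-Analysis.Analysis"
begin

section \<open>Smooth maps on open subsets of Euclidean spaces\<close>

text \<open>The set \<open>S\<close> is always open in the uses below, so that derivatives
  are taken at interior points.\<close>

primrec Ck_on :: "nat \<Rightarrow> 'a::euclidean_space set \<Rightarrow> ('a \<Rightarrow> 'b::real_normed_vector) \<Rightarrow> bool" where
  "Ck_on 0 S f \<longleftrightarrow> continuous_on S f"
| "Ck_on (Suc k) S f \<longleftrightarrow>
     (\<forall>x\<in>S. f differentiable (at x)) \<and>
     (\<forall>v. Ck_on k S (\<lambda>x. frechet_derivative f (at x) v))"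

definition smooth_on :: "'a::euclidean_space set \<Rightarrow> ('a \<Rightarrow> 'b::real_normed_vector) \<Rightarrow> bool" where
  "smooth_on S f \<longleftrightarrow> (\<forall>k. Ck_on k S f)"


section \<open>Smooth manifolds\<close>

text \<open>A chart is its domain together with its coordinate map; the values of the map
  outside the domain are irrelevant.  A manifold is given by an atlas modelled on \<open>'e\<close>:
  its underlying set is the union of the chart domains, and its topology is the one for which
  all charts are homeomorphisms onto open subsets of \<open>'e\<close>.\<close>

type_synonym ('m, 'e) chart = "'m set \<times> ('m \<Rightarrow> 'e)"

definition chart_inv :: "('m, 'e) chart \<Rightarrow> 'e \<Rightarrow> 'm" where
  "chart_inv c = inv_into (fst c) (snd c)"

text \<open>For an injective chart, this is the image under the chart of the part of \<open>U\<close>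
  inside its domain.\<close>

definition in_chart :: "('m, 'e) chart \<Rightarrow> 'm set \<Rightarrow> 'e set" where
  "in_chart c U = {x \<in> snd c ` fst c. chart_inv c x \<in> U}"

definition carrier_of :: "('m, 'e) chart set \<Rightarrow> 'm set" where
  "carrier_of A = (\<Union>c\<in>A. fst c)"

definition atlas_topology :: "('m, 'e::euclidean_space) chart set \<Rightarrow> 'm topology" where
  "atlas_topology A = topology (\<lambda>U. U \<subseteq> carrier_of A \<and> (\<forall>c\<in>A. open (in_chart c U)))"

definition transition :: "('m, 'e) chart \<Rightarrow> ('m, 'e) chart \<Rightarrow> 'e \<Rightarrow> 'e" where
  "transition c d = snd d \<circ> chart_inv c"

definition smooth_atlas :: "('m, 'e::euclidean_space) chart set \<Rightarrow> bool" where
  "smooth_atlas A \<longleftrightarrow>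
     (\<forall>c\<in>A. inj_on (snd c) (fst c) \<and> open (snd c ` fst c)) \<and>
     (\<forall>c\<in>A. \<forall>d\<in>A. open (in_chart c (fst d)) \<and> smooth_on (in_chart c (fst d)) (transition c d))"

definition smooth_manifold :: "('m, 'e::euclidean_space) chart set \<Rightarrow> bool" where
  "smooth_manifold A \<longleftrightarrow>
     smooth_atlas A \<and> Hausdorff_space (atlas_topology A) \<and> second_countable (atlas_topology A)"

definition smooth_function :: "('m, 'e::euclidean_space) chart set \<Rightarrow> 'm set \<Rightarrow> ('m \<Rightarrow> real) \<Rightarrow> bool" where
  "smooth_function A U f \<longleftrightarrow> (\<forall>c\<in>A. smooth_on (in_chart c U) (f \<circ> chart_inv c))"

lemma openin_atlas_topology:
  "openin (atlas_topology A) U \<longleftrightarrow> U \<subseteq> carrier_of A \<and> (\<forall>c\<in>A. open (in_chart c U))"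
proof -
  have inter: "in_chart c (U \<inter> V) = in_chart c U \<inter> in_chart c V"
    for c :: "('a, 'b) chart" and U V
    by (auto simp: in_chart_def)
  have union: "in_chart c (\<Union>K) = (\<Union>U\<in>K. in_chart c U)"
    for c :: "('a, 'b) chart" and K
    by (auto simp: in_chart_def)
  have "istopology (\<lambda>U. U \<subseteq> carrier_of A \<and> (\<forall>c\<in>A. open (in_chart c U)))"
    unfolding istopology_def by (auto simp: inter union)
  then show ?thesis
    unfolding atlas_topology_def by (simp add: topology_inverse')
qed


section \<open>The tangent bundle\<close>

text \<open>A tangent vector at \<open>p\<close> is the family of its components in all charts around \<open>p\<close>;
  the components in two charts are related by the Jacobian of the transition map.  Charts
  that do not contain \<open>p\<close> are assigned the dummy value \<open>0\<close>.\<close>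

type_synonym ('m, 'e) vec_comps = "('m, 'e) chart \<Rightarrow> 'e"

definition tangent_space ::
    "('m, 'e::euclidean_space) chart set \<Rightarrow> 'm \<Rightarrow> ('m, 'e) vec_comps set" where
  "tangent_space A p = {v.
     (\<forall>c. c \<notin> A \<or> p \<notin> fst c \<longrightarrow> v c = 0) \<and>
     (\<forall>c\<in>A. \<forall>d\<in>A. p \<in> fst c \<and> p \<in> fst d \<longrightarrow>
        v d = frechet_derivative (transition c d) (at (snd c p)) (v c))}"

text \<open>The tangent bundle is again a manifold, modelled on \<open>'e \<times> 'e\<close>; the chart induced by a
  chart \<open>c\<close> has the coordinates \<open>(x, y)\<close>.\<close>

type_synonym ('m, 'e) tangent = "'m \<times> ('m, 'e) vec_comps"

definition tangent_chart ::
    "('m, 'e::euclidean_space) chart set \<Rightarrow> ('m, 'e) chart \<Rightarrow> (('m, 'e) tangent, 'e \<times> 'e) chart" where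
  "tangent_chart A c =
     ({(p, v). p \<in> fst c \<and> v \<in> tangent_space A p}, (\<lambda>(p, v). (snd c p, v c)))"

definition tangent_atlas ::
    "('m, 'e::euclidean_space) chart set \<Rightarrow> (('m, 'e) tangent, 'e \<times> 'e) chart set" where
  "tangent_atlas A = tangent_chart A ` A"

definition smooth_vector_field ::
    "('m, 'e::euclidean_space) chart set \<Rightarrow> 'm set \<Rightarrow> ('m \<Rightarrow> ('m, 'e) vec_comps) \<Rightarrow> bool" where
  "smooth_vector_field A U X \<longleftrightarrow>
     (\<forall>p\<in>U. X p \<in> tangent_space A p) \<and>
     (\<forall>c\<in>A. smooth_on (in_chart c U) (\<lambda>x. X (chart_inv c x) c))"

definition scale_tangent :: "real \<Rightarrow> ('m, 'e::euclidean_space) tangent \<Rightarrow> ('m, 'e) tangent" where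
  "scale_tangent t z = (fst z, (\<lambda>c. t *\<^sub>R snd z c))"

definition conical_region ::
    "('m, 'e::euclidean_space) chart set \<Rightarrow> ('m, 'e) tangent set \<Rightarrow> bool" where
  "conical_region A \<Omega> \<longleftrightarrow>
     openin (atlas_topology (tangent_atlas A)) \<Omega> \<and>
     (\<forall>z\<in>\<Omega>. snd z \<noteq> (\<lambda>_. 0)) \<and>
     (\<forall>z\<in>\<Omega>. \<forall>t>0. scale_tangent t z \<in> \<Omega>)"

definition pos_homogeneous ::
    "('m, 'e::euclidean_space) tangent set \<Rightarrow> nat \<Rightarrow> (('m, 'e) tangent \<Rightarrow> real) \<Rightarrow> bool" where
  "pos_homogeneous \<Omega> d f \<longleftrightarrow> (\<forall>z\<in>\<Omega>. \<forall>t>0. f (scale_tangent t z) = t ^ d * f z)"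

text \<open>The region \<open>\<Omega>\<close> and a function on it, expressed in the coordinates \<open>(x, y)\<close> of a chart.\<close>

definition loc_region ::
    "('m, 'e::euclidean_space) chart set \<Rightarrow> ('m, 'e) chart \<Rightarrow> ('m, 'e) tangent set \<Rightarrow> ('e \<times> 'e) set" where
  "loc_region A c \<Omega> = in_chart (tangent_chart A c) \<Omega>"

definition loc_fun ::
    "('m, 'e::euclidean_space) chart set \<Rightarrow> ('m, 'e) chart \<Rightarrow> (('m, 'e) tangent \<Rightarrow> real) \<Rightarrow> 'e \<times> 'e \<Rightarrow> real" where
  "loc_fun A c f = f \<circ> chart_inv (tangent_chart A c)"

definition loc_pos_homogeneous ::
    "('e \<times> 'e) set \<Rightarrow> nat \<Rightarrow> ('e::real_vector \<times> 'e \<Rightarrow> 'b::real_vector) \<Rightarrow> bool" where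
  "loc_pos_homogeneous W d f \<longleftrightarrow>
     (\<forall>(x, y)\<in>W. \<forall>t>0. f (x, t *\<^sub>R y) = t ^ d *\<^sub>R f (x, y))"


section \<open>Sprays\<close>

type_synonym ('m, 'e) tangent_field =
  "('m, 'e) tangent \<Rightarrow> (('m, 'e) tangent, 'e \<times> 'e) vec_comps"

text \<open>\<open>loc_field A c G (x, y)\<close> is the pair of coefficient vectors of
  \<open>\<partial>/\<partial>x\<close> and \<open>\<partial>/\<partial>y\<close>; for a spray it equals \<open>(y, -2 G\<^sup>i(x, y))\<close>, which defines
  the functions \<open>G\<^sup>i\<close>.\<close>

definition loc_field ::
    "('m, 'e::euclidean_space) chart set \<Rightarrow> ('m, 'e) chart \<Rightarrow> ('m, 'e) tangent_field \<Rightarrow> 'e \<times> 'e \<Rightarrow> 'e \<times> 'e" where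
  "loc_field A c G z = G (chart_inv (tangent_chart A c) z) (tangent_chart A c)"

definition spray_coeff ::
    "('m, 'e::euclidean_space) chart set \<Rightarrow> ('m, 'e) chart \<Rightarrow> ('m, 'e) tangent_field \<Rightarrow> 'e \<times> 'e \<Rightarrow> 'e" where
  "spray_coeff A c G z = - (1/2) *\<^sub>R snd (loc_field A c G z)"

definition spray ::
    "('m, 'e::euclidean_space) chart set \<Rightarrow> ('m, 'e) tangent set \<Rightarrow> ('m, 'e) tangent_field \<Rightarrow> bool" where
  "spray A \<Omega> G \<longleftrightarrow>
     conical_region A \<Omega> \<and>
     smooth_vector_field (tangent_atlas A) \<Omega> G \<and>
     (\<forall>c\<in>A. (\<forall>(x, y)\<in>loc_region A c \<Omega>. fst (loc_field A c G (x, y)) = y) \<and>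
            loc_pos_homogeneous (loc_region A c \<Omega>) 2 (spray_coeff A c G))"

definition projectively_related ::
    "('m, 'e::euclidean_space) chart set \<Rightarrow> ('m, 'e) tangent set \<Rightarrow>
     ('m, 'e) tangent_field \<Rightarrow> ('m, 'e) tangent_field \<Rightarrow> (('m, 'e) tangent \<Rightarrow> real) \<Rightarrow> bool" where
  "projectively_related A \<Omega> Gbar G P \<longleftrightarrow>
     pos_homogeneous \<Omega> 1 P \<and>
     (\<forall>c\<in>A. \<forall>(x, y)\<in>loc_region A c \<Omega>.
        spray_coeff A c Gbar (x, y) = spray_coeff A c G (x, y) + loc_fun A c P (x, y) *\<^sub>R y)"


section \<open>Local formulas: Berwald connection and curvature\<close>

text \<open>\<open>dx k\<close> and \<open>dy k\<close> are the partial derivatives \<open>\<partial>/\<partial>x\<^sup>k\<close> and \<open>\<partial>/\<partial>y\<^sup>k\<close>.\<close>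

definition dx :: "'n::finite \<Rightarrow> ((real^'n) \<times> (real^'n) \<Rightarrow> real) \<Rightarrow> (real^'n) \<times> (real^'n) \<Rightarrow> real" where
  "dx k f z = frechet_derivative f (at z) (axis k 1, 0)"

definition dy :: "'n::finite \<Rightarrow> ((real^'n) \<times> (real^'n) \<Rightarrow> real) \<Rightarrow> (real^'n) \<times> (real^'n) \<Rightarrow> real" where
  "dy k f z = frechet_derivative f (at z) (0, axis k 1)"

type_synonym 'n coeffs = "(real^'n) \<times> (real^'n) \<Rightarrow> real^'n"

text \<open>\<open>riemann G i k\<close> is \<open>R\<^sup>i\<^sub>k\<close>.\<close>

definition riemann :: "'n::finite coeffs \<Rightarrow> 'n \<Rightarrow> 'n \<Rightarrow> (real^'n) \<times> (real^'n) \<Rightarrow> real" where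
  "riemann G i k z =
     2 * dx k (\<lambda>w. G w $ i) z
     - (\<Sum>j\<in>UNIV. snd z $ j * dx j (dy k (\<lambda>w. G w $ i)) z)
     + 2 * (\<Sum>j\<in>UNIV. G z $ j * dy j (dy k (\<lambda>w. G w $ i)) z)
     - (\<Sum>j\<in>UNIV. dy j (\<lambda>w. G w $ i) z * dy k (\<lambda>w. G w $ j) z)"

definition ricci :: "'n::finite coeffs \<Rightarrow> (real^'n) \<times> (real^'n) \<Rightarrow> real" where
  "ricci G z = (\<Sum>i\<in>UNIV. riemann G i i z)"

text \<open>\<open>conn1 G r i\<close> is \<open>G\<^sup>r\<^sub>i\<close> and \<open>conn2 G r i j\<close> is \<open>G\<^sup>r\<^sub>i\<^sub>j\<close>; \<open>delta G k f\<close> is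
  \<open>f\<^sub>;\<^sub>k\<close>, \<open>hor_0 G f\<close> is \<open>f\<^sub>;\<^sub>0\<close>, \<open>dot_hor G k j f\<close> is \<open>f\<^sub>.\<^sub>k\<^sub>;\<^sub>j\<close> and
  \<open>dot_hor_0 G k f\<close> is \<open>f\<^sub>.\<^sub>k\<^sub>;\<^sub>0\<close>.\<close>

definition conn1 :: "'n::finite coeffs \<Rightarrow> 'n \<Rightarrow> 'n \<Rightarrow> (real^'n) \<times> (real^'n) \<Rightarrow> real" where
  "conn1 G r i = dy i (\<lambda>w. G w $ r)"

definition conn2 :: "'n::finite coeffs \<Rightarrow> 'n \<Rightarrow> 'n \<Rightarrow> 'n \<Rightarrow> (real^'n) \<times> (real^'n) \<Rightarrow> real" where
  "conn2 G r i j = dy j (dy i (\<lambda>w. G w $ r))"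

definition delta ::
    "'n::finite coeffs \<Rightarrow> 'n \<Rightarrow> ((real^'n) \<times> (real^'n) \<Rightarrow> real) \<Rightarrow> (real^'n) \<times> (real^'n) \<Rightarrow> real" where
  "delta G k f z = dx k f z - (\<Sum>r\<in>UNIV. conn1 G r k z * dy r f z)"

definition hor_0 ::
    "'n::finite coeffs \<Rightarrow> ((real^'n) \<times> (real^'n) \<Rightarrow> real) \<Rightarrow> (real^'n) \<times> (real^'n) \<Rightarrow> real" where
  "hor_0 G f z = (\<Sum>k\<in>UNIV. delta G k f z * snd z $ k)"

definition dot_hor ::
    "'n::finite coeffs \<Rightarrow> 'n \<Rightarrow> 'n \<Rightarrow> ((real^'n) \<times> (real^'n) \<Rightarrow> real) \<Rightarrow> (real^'n) \<times> (real^'n) \<Rightarrow> real" where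
  "dot_hor G k j f z = delta G j (dy k f) z - (\<Sum>r\<in>UNIV. dy r f z * conn2 G r k j z)"

definition dot_hor_0 ::
    "'n::finite coeffs \<Rightarrow> 'n \<Rightarrow> ((real^'n) \<times> (real^'n) \<Rightarrow> real) \<Rightarrow> (real^'n) \<times> (real^'n) \<Rightarrow> real" where
  "dot_hor_0 G k f z = (\<Sum>j\<in>UNIV. dot_hor G k j f z * snd z $ j)"


section \<open>Funk, weak Funk and Hamel functions; isotropic curvature\<close>

definition funk_function ::
    "('m, real^'n::finite) chart set \<Rightarrow> ('m, real^'n) tangent set \<Rightarrow> ('m, real^'n) tangent_field \<Rightarrow>
     (('m, real^'n) tangent \<Rightarrow> real) \<Rightarrow> bool" where
  "funk_function A \<Omega> G P \<longleftrightarrow>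
     pos_homogeneous \<Omega> 1 P \<and>
     (\<forall>c\<in>A. \<forall>z\<in>loc_region A c \<Omega>. \<forall>k.
        delta (spray_coeff A c G) k (loc_fun A c P) z = loc_fun A c P z * dy k (loc_fun A c P) z)"

definition weak_funk_function ::
    "('m, real^'n::finite) chart set \<Rightarrow> ('m, real^'n) tangent set \<Rightarrow> ('m, real^'n) tangent_field \<Rightarrow>
     (('m, real^'n) tangent \<Rightarrow> real) \<Rightarrow> bool" where
  "weak_funk_function A \<Omega> G P \<longleftrightarrow>
     pos_homogeneous \<Omega> 1 P \<and>
     (\<forall>c\<in>A. \<forall>z\<in>loc_region A c \<Omega>.
        hor_0 (spray_coeff A c G) (loc_fun A c P) z = (loc_fun A c P z)\<^sup>2)"

definition hamel_function ::
    "('m, real^'n::finite) chart set \<Rightarrow> ('m, real^'n) tangent set \<Rightarrow> ('m, real^'n) tangent_field \<Rightarrow>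
     (('m, real^'n) tangent \<Rightarrow> real) \<Rightarrow> bool" where
  "hamel_function A \<Omega> G P \<longleftrightarrow>
     pos_homogeneous \<Omega> 1 P \<and>
     (\<forall>c\<in>A. \<forall>z\<in>loc_region A c \<Omega>. \<forall>k.
        delta (spray_coeff A c G) k (loc_fun A c P) z = dot_hor_0 (spray_coeff A c G) k (loc_fun A c P) z)"

text \<open>\<open>R\<close> is a function on the region and \<open>\<tau> c k\<close> is the \<open>k\<close>-th component of \<open>\<tau>\<close> in the
  chart \<open>c\<close>; since \<open>R\<^sub>.\<^sub>k = 2 \<tau>\<^sub>k\<close> is required in every chart, these components transform as a
  covector.  The degrees of homogeneity are those for which \<open>R\<^sup>i\<^sub>k\<close> has its degree two.\<close>

definition isotropic_curvature ::
    "('m, real^'n::finite) chart set \<Rightarrow> ('m, real^'n) tangent set \<Rightarrow> ('m, real^'n) tangent_field \<Rightarrow> bool" where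
  "isotropic_curvature A \<Omega> G \<longleftrightarrow>
     (\<exists>R \<tau>.
        smooth_function (tangent_atlas A) \<Omega> R \<and> pos_homogeneous \<Omega> 2 R \<and>
        (\<forall>c\<in>A. \<forall>k. smooth_on (loc_region A c \<Omega>) (\<tau> c k) \<and>
                   loc_pos_homogeneous (loc_region A c \<Omega>) 1 (\<tau> c k)) \<and>
        (\<forall>c\<in>A. \<forall>z\<in>loc_region A c \<Omega>. \<forall>i k.
           riemann (spray_coeff A c G) i k z =
             loc_fun A c R z * (if i = k then 1 else 0) - \<tau> c k z * snd z $ i) \<and>
        (\<forall>c\<in>A. \<forall>z\<in>loc_region A c \<Omega>. \<forall>k. dy k (loc_fun A c R) z = 2 * \<tau> c k z))"

end

theory Submission
  imports Defs
begin

text \<open>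
  The change of the curvature is computed in the coordinates \<open>(x, y)\<close> of one chart.  Substituting
  \<open>Gbar\<^sup>i = G\<^sup>i + P y\<^sup>i\<close> into the formula for the Riemann curvature and simplifying with
  Euler's relation for homogeneous functions gives (lemma \<open>riemann_Gbar\<close>)

  \<open>Rbar\<^sup>i\<^sub>k = R\<^sup>i\<^sub>k + \<Xi> \<delta>\<^sup>i\<^sub>k + \<tau>\<^sub>k y\<^sup>i\<close>
  with \<open>\<Xi> = P\<^sup>2 - P\<^sub>;\<^sub>0\<close> and \<open>\<tau>\<^sub>k = 2 P\<^sub>;\<^sub>k - P\<^sub>.\<^sub>k\<^sub>;\<^sub>0 - P P\<^sub>.\<^sub>k\<close>.

  Two further identities carry the rest.  Contraction gives \<open>\<tau>\<^sub>k y\<^sup>k = - \<Xi>\<close> (\<open>contract_tau\<close>), so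
  that the trace of the formula is \<open>Ricbar = Ric + (n - 1) \<Xi>\<close>; this is the statement on weak Funk
  functions.  And since second derivatives commute, \<open>(P\<^sub>;\<^sub>0)\<^sub>.\<^sub>k = P\<^sub>;\<^sub>k + P\<^sub>.\<^sub>k\<^sub>;\<^sub>0\<close>
  (\<open>dy_spray_derivative\<close>), whence \<open>\<Xi>\<^sub>.\<^sub>k = 2 P P\<^sub>.\<^sub>k - P\<^sub>;\<^sub>k - P\<^sub>.\<^sub>k\<^sub>;\<^sub>0\<close>.

  In dimension at least two, \<open>\<delta>\<^sup>i\<^sub>k\<close> is not of the form \<open>\<sigma>\<^sub>k y\<^sup>i\<close>, so that the curvatures agree
  if and only if \<open>\<Xi>\<close> and all \<open>\<tau>\<^sub>k\<close> vanish.  The equations \<open>\<Xi>\<^sub>.\<^sub>k = 0\<close> and \<open>\<tau>\<^sub>k = 0\<close> form a linear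
  system for \<open>P\<^sub>;\<^sub>k\<close> and \<open>P\<^sub>.\<^sub>k\<^sub>;\<^sub>0\<close>, with the solution \<open>P\<^sub>;\<^sub>k = P\<^sub>.\<^sub>k\<^sub>;\<^sub>0 = P P\<^sub>.\<^sub>k\<close>; conversely \<open>\<Xi> = 0\<close>
  and \<open>\<tau>\<^sub>k = 0\<close> hold for every Funk function.  If \<open>G\<close> is isotropic, then the curvature of \<open>Gbar\<close>
  has the isotropic form with \<open>R + \<Xi>\<close> as its scalar and the \<open>\<tau>\<^sub>k\<close> of \<open>G\<close> decreased by those
  above as its covector; the required relation between the two is \<open>\<Xi>\<^sub>.\<^sub>k = - 2 \<tau>\<^sub>k\<close>, which
  says \<open>P\<^sub>;\<^sub>k = P\<^sub>.\<^sub>k\<^sub>;\<^sub>0\<close>.  In dimension one the Hamel condition holds for every \<open>P\<close>.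

  Isotropic curvature asks for a scalar on the region of the tangent bundle.  That \<open>\<Xi>\<close> is
  one follows from \<open>P\<^sub>;\<^sub>0\<close> being the derivative of \<open>P\<close> along the vector field \<open>G\<close>, which is
  independent of the chart by the chain rule (\<open>chart_derivative_independent\<close>).
\<close>

section \<open>Smooth functions and their directional derivatives\<close>

lemma frechet_derivative_eqI:
  "(f has_derivative f') (at x) \<Longrightarrow> frechet_derivative f (at x) = f'"
  by (simp add: frechet_derivative_at[symmetric])

lemma Ck_on_cong:
  assumes "open S" "\<And>x. x \<in> S \<Longrightarrow> f x = g x"
  shows "Ck_on k S f \<longleftrightarrow> Ck_on k S g"
  using assms(2)
proof (induction k arbitrary: f g)
  case 0
  then show ?case using continuous_on_cong[of S S f g] by simp
next
  case (Suc k)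
  have diff: "f differentiable (at x) \<longleftrightarrow> g differentiable (at x)" if "x \<in> S" for x
    using has_derivative_transform_within_open[OF _ \<open>open S\<close> that] Suc.prems
    unfolding differentiable_def by (metis (no_types, lifting))
  show ?case
  proof (cases "\<forall>x\<in>S. f differentiable (at x)")
    case True
    have "frechet_derivative f (at x) v = frechet_derivative g (at x) v" if "x \<in> S" for x v
      using frechet_derivative_transform_within_open[of f x S g] True \<open>open S\<close> that Suc.prems
      by auto
    then have "Ck_on k S (\<lambda>x. frechet_derivative f (at x) v) \<longleftrightarrow>
        Ck_on k S (\<lambda>x. frechet_derivative g (at x) v)" for v
      by (rule Suc.IH)
    then show ?thesis using diff by simp
  qed (use diff in auto)
qed

text \<open>The predicate \<open>Ck_on\<close> speaks of \<open>frechet_derivative\<close>, a choice operator.  On an open set an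
  explicit formula for the derivative may take its place, and this turns each closure property
  below into an induction on \<open>k\<close> with the usual differentiation rule as its step.\<close>

lemma Ck_on_SucI:
  assumes "open S" "\<And>x. x \<in> S \<Longrightarrow> (f has_derivative D x) (at x)"
    and "\<And>v. Ck_on k S (\<lambda>x. D x v)"
  shows "Ck_on (Suc k) S f"
proof -
  have "Ck_on k S (\<lambda>x. frechet_derivative f (at x) v)" for v
    using Ck_on_cong[of S "\<lambda>x. frechet_derivative f (at x) v" "\<lambda>x. D x v" k]
      assms frechet_derivative_eqI[OF assms(2)] by simp
  then show ?thesis using assms(2) by (auto simp: differentiable_def)
qed

lemma Ck_on_mono: "Ck_on (Suc k) S f \<Longrightarrow> Ck_on k S f"
proof (induction k arbitrary: f)
  case 0
  then have "f differentiable_on S"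
    by (auto simp: differentiable_on_def intro: differentiable_at_withinI)
  then show ?case by (simp add: differentiable_imp_continuous_on)
next
  case (Suc k)
  then show ?case by auto
qed

lemma Ck_on_const: "Ck_on k S (\<lambda>_. c)"
  by (induction k arbitrary: c) auto

lemma Ck_on_Suc_has_derivative:
  "Ck_on (Suc k) S f \<Longrightarrow> x \<in> S \<Longrightarrow> (f has_derivative frechet_derivative f (at x)) (at x)"
  by (simp add: frechet_derivative_works[symmetric])

lemma Ck_on_add:
  assumes "open S" "Ck_on k S f" "Ck_on k S g"
  shows "Ck_on k S (\<lambda>x. f x + g x)"
  using assms(2,3)
proof (induction k arbitrary: f g)
  case 0
  then show ?case by (simp add: continuous_on_add)
next
  case (Suc k)
  show ?case
  proof (rule Ck_on_SucI[OF \<open>open S\<close>])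
    show "((\<lambda>x. f x + g x) has_derivative
        (\<lambda>v. frechet_derivative f (at x) v + frechet_derivative g (at x) v)) (at x)"
      if "x \<in> S" for x
      using that by (intro has_derivative_add Suc.prems[THEN Ck_on_Suc_has_derivative])
    show "Ck_on k S (\<lambda>x. frechet_derivative f (at x) v + frechet_derivative g (at x) v)" for v
      using Suc.prems by (intro Suc.IH) auto
  qed
qed

lemma Ck_on_mult:
  fixes f g :: "'a::euclidean_space \<Rightarrow> real"
  assumes "open S" "Ck_on k S f" "Ck_on k S g"
  shows "Ck_on k S (\<lambda>x. f x * g x)"
  using assms(2,3)
proof (induction k arbitrary: f g)
  case 0
  then show ?case by (simp add: continuous_on_mult)
next
  case (Suc k)
  show ?case
  proof (rule Ck_on_SucI[OF \<open>open S\<close>])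
    show "((\<lambda>x. f x * g x) has_derivative
        (\<lambda>v. f x * frechet_derivative g (at x) v + frechet_derivative f (at x) v * g x)) (at x)"
      if "x \<in> S" for x
      using that by (intro has_derivative_mult Suc.prems[THEN Ck_on_Suc_has_derivative])
    show "Ck_on k S (\<lambda>x. f x * frechet_derivative g (at x) v + frechet_derivative f (at x) v * g x)"
      for v
      using Suc.prems Suc.prems[THEN Ck_on_mono]
      by (intro Ck_on_add[OF \<open>open S\<close>] Suc.IH) auto
  qed
qed

lemma Ck_on_inverse:
  fixes f :: "'a::euclidean_space \<Rightarrow> real"
  assumes "open S" "\<And>x. x \<in> S \<Longrightarrow> f x \<noteq> 0" "Ck_on k S f"
  shows "Ck_on k S (\<lambda>x. inverse (f x))"
  using assms(3)
proof (induction k)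
  case 0
  then show ?case using assms(2) by (simp add: continuous_on_inverse)
next
  case (Suc k)
  show ?case
  proof (rule Ck_on_SucI[OF \<open>open S\<close>])
    show "((\<lambda>x. inverse (f x)) has_derivative
        (\<lambda>v. (- 1) * (inverse (f x) * frechet_derivative f (at x) v * inverse (f x)))) (at x)"
      if "x \<in> S" for x
      using Deriv.has_derivative_inverse[OF assms(2)[OF that] Ck_on_Suc_has_derivative[OF Suc.prems that]]
      by simp
    show "Ck_on k S (\<lambda>x. (- 1) * (inverse (f x) * frechet_derivative f (at x) v * inverse (f x)))"
      for v
      using Suc.prems Suc.IH[OF Ck_on_mono[OF Suc.prems]]
      by (intro Ck_on_mult[OF \<open>open S\<close>] Ck_on_const) auto
  qed
qed

lemma Ck_on_linear:
  assumes "bounded_linear L"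
  shows "Ck_on k S L"
proof (cases k)
  case 0
  then show ?thesis using assms by (simp add: linear_continuous_on)
next
  case (Suc j)
  have der: "(L has_derivative L) (at x)" for x
    using assms by (rule bounded_linear_imp_has_derivative)
  then show ?thesis
    using Suc by (auto simp: frechet_derivative_eqI[OF der] differentiable_def intro!: Ck_on_const)
qed

lemma Ck_on_linear_compose:
  assumes "open S" "bounded_linear L" "Ck_on k S f"
  shows "Ck_on k S (\<lambda>x. L (f x))"
  using assms(3)
proof (induction k arbitrary: f)
  case 0
  then show ?case
    using assms(2) by (simp add: bounded_linear.continuous_on)
next
  case (Suc k)
  show ?case
  proof (rule Ck_on_SucI[OF \<open>open S\<close>])
    show "((\<lambda>x. L (f x)) has_derivative (\<lambda>v. L (frechet_derivative f (at x) v))) (at x)"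
      if "x \<in> S" for x
      by (intro bounded_linear.has_derivative[OF assms(2)] Ck_on_Suc_has_derivative[OF Suc.prems that])
    show "Ck_on k S (\<lambda>x. L (frechet_derivative f (at x) v))" for v
      using Suc.prems by (intro Suc.IH) auto
  qed
qed

lemma smooth_on_cong:
  "open S \<Longrightarrow> (\<And>x. x \<in> S \<Longrightarrow> f x = g x) \<Longrightarrow> smooth_on S f \<longleftrightarrow> smooth_on S g"
  unfolding smooth_on_def using Ck_on_cong by blast

lemma smooth_on_const: "smooth_on S (\<lambda>_. c)"
  by (simp add: smooth_on_def Ck_on_const)

lemma smooth_on_add:
  "open S \<Longrightarrow> smooth_on S f \<Longrightarrow> smooth_on S g \<Longrightarrow> smooth_on S (\<lambda>x. f x + g x)"
  by (simp add: smooth_on_def Ck_on_add)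

lemma smooth_on_mult:
  fixes f g :: "'a::euclidean_space \<Rightarrow> real"
  shows "open S \<Longrightarrow> smooth_on S f \<Longrightarrow> smooth_on S g \<Longrightarrow> smooth_on S (\<lambda>x. f x * g x)"
  by (simp add: smooth_on_def Ck_on_mult)

lemma smooth_on_diff:
  fixes f g :: "'a::euclidean_space \<Rightarrow> real"
  assumes "open S" "smooth_on S f" "smooth_on S g"
  shows "smooth_on S (\<lambda>x. f x - g x)"
  using smooth_on_add[OF assms(1,2) smooth_on_mult[OF assms(1) smooth_on_const[of S "-1"] assms(3)]]
  by simp

lemma smooth_on_power2:
  fixes f :: "'a::euclidean_space \<Rightarrow> real"
  shows "open S \<Longrightarrow> smooth_on S f \<Longrightarrow> smooth_on S (\<lambda>x. (f x)\<^sup>2)"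
  by (simp add: power2_eq_square smooth_on_mult)

lemma smooth_on_sum:
  "open S \<Longrightarrow> (\<And>i. i \<in> I \<Longrightarrow> smooth_on S (f i)) \<Longrightarrow> smooth_on S (\<lambda>x. \<Sum>i\<in>I. f i x)"
  by (induction I rule: infinite_finite_induct) (auto intro: smooth_on_add smooth_on_const)

lemma smooth_on_inverse:
  fixes f :: "'a::euclidean_space \<Rightarrow> real"
  shows "open S \<Longrightarrow> (\<And>x. x \<in> S \<Longrightarrow> f x \<noteq> 0) \<Longrightarrow> smooth_on S f \<Longrightarrow>
    smooth_on S (\<lambda>x. inverse (f x))"
  by (simp add: smooth_on_def Ck_on_inverse)

lemma smooth_on_linear: "bounded_linear L \<Longrightarrow> smooth_on S L"
  by (simp add: smooth_on_def Ck_on_linear)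

lemma smooth_on_linear_compose:
  "open S \<Longrightarrow> bounded_linear L \<Longrightarrow> smooth_on S f \<Longrightarrow> smooth_on S (\<lambda>x. L (f x))"
  by (simp add: smooth_on_def Ck_on_linear_compose)

lemma smooth_on_imp_differentiable: "smooth_on S f \<Longrightarrow> x \<in> S \<Longrightarrow> f differentiable (at x)"
  unfolding smooth_on_def by (metis Ck_on.simps(2))

lemma smooth_on_has_derivative:
  "smooth_on S f \<Longrightarrow> x \<in> S \<Longrightarrow> (f has_derivative frechet_derivative f (at x)) (at x)"
  using smooth_on_imp_differentiable frechet_derivative_works by blast

lemma smooth_on_continuous: "smooth_on S f \<Longrightarrow> continuous_on S f"
  unfolding smooth_on_def by (metis Ck_on.simps(1))

lemma smooth_on_deriv: "smooth_on S f \<Longrightarrow> smooth_on S (\<lambda>x. frechet_derivative f (at x) v)"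
  unfolding smooth_on_def by (metis Ck_on.simps(2))

text \<open>The second difference over a small parallelogram is a mixed second derivative at some
  inner point, by two applications of the mean value theorem.  Since the second difference
  does not distinguish the two sides, this gives the symmetry of mixed derivatives.\<close>

lemma second_difference_mean_value:
  fixes f :: "'a::euclidean_space \<Rightarrow> real"
  assumes "smooth_on S f" "h > 0"
    and S: "\<And>s t. 0 \<le> s \<Longrightarrow> s \<le> h \<Longrightarrow> 0 \<le> t \<Longrightarrow> t \<le> h \<Longrightarrow> z + s *\<^sub>R u + t *\<^sub>R v \<in> S"
  obtains s t where "0 \<le> s" "s \<le> h" "0 \<le> t" "t \<le> h"
    "f (z + h *\<^sub>R u + h *\<^sub>R v) - f (z + h *\<^sub>R u) - f (z + h *\<^sub>R v) + f z =
     h * (h * frechet_derivative (\<lambda>x. frechet_derivative f (at x) u) (at (z + s *\<^sub>R u + t *\<^sub>R v)) v)"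
proof -
  have line: "((\<lambda>s. g (p + s *\<^sub>R w)) has_real_derivative
      frechet_derivative g (at (p + s *\<^sub>R w)) w) (at s)"
    if "smooth_on S g" "p + s *\<^sub>R w \<in> S" for g :: "'a \<Rightarrow> real" and p w s
  proof -
    have d: "((\<lambda>s. p + s *\<^sub>R w) has_derivative (\<lambda>s. s *\<^sub>R w)) (at s)"
      by (auto intro!: derivative_eq_intros)
    have "((\<lambda>s. g (p + s *\<^sub>R w)) has_derivative
        (\<lambda>r. frechet_derivative g (at (p + s *\<^sub>R w)) (r *\<^sub>R w))) (at s)"
      using diff_chain_at[OF d smooth_on_has_derivative[OF that]] by (simp add: o_def)
    then show ?thesis
      using linear_frechet_derivative[OF smooth_on_imp_differentiable[OF that]]
      by (simp add: has_field_derivative_def linear_scale mult.commute[of _ "frechet_derivative _ _ _"] mult_commute_abs)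
  qed
  define D where "D = (\<lambda>x. frechet_derivative f (at x) u)"
  have D: "smooth_on S D" unfolding D_def by (rule smooth_on_deriv) fact
  define \<phi> where "\<phi> s = f ((z + h *\<^sub>R v) + s *\<^sub>R u) - f (z + s *\<^sub>R u)" for s
  have in1: "(z + h *\<^sub>R v) + s *\<^sub>R u \<in> S" if "0 \<le> s" "s \<le> h" for s
    using S[of s h] that \<open>h > 0\<close> by (simp add: algebra_simps)
  have in2: "z + s *\<^sub>R u \<in> S" if "0 \<le> s" "s \<le> h" for s
    using S[of s 0] that \<open>h > 0\<close> by simp
  have "DERIV \<phi> s :> D ((z + h *\<^sub>R v) + s *\<^sub>R u) - D (z + s *\<^sub>R u)" if "0 \<le> s" "s \<le> h" for s
    unfolding \<phi>_def D_def using that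
    by (intro DERIV_diff line assms(1) in1 in2)
  then obtain s where s: "0 < s" "s < h"
      "\<phi> h - \<phi> 0 = (h - 0) * (D ((z + h *\<^sub>R v) + s *\<^sub>R u) - D (z + s *\<^sub>R u))"
    using MVT2[OF \<open>h > 0\<close>, of \<phi> "\<lambda>s. D ((z + h *\<^sub>R v) + s *\<^sub>R u) - D (z + s *\<^sub>R u)"] by auto
  have "DERIV (\<lambda>t. D ((z + s *\<^sub>R u) + t *\<^sub>R v)) t :>
      frechet_derivative D (at ((z + s *\<^sub>R u) + t *\<^sub>R v)) v" if "0 \<le> t" "t \<le> h" for t
    using that s S by (intro line D) auto
  then obtain t where t: "0 < t" "t < h"
      "D ((z + s *\<^sub>R u) + h *\<^sub>R v) - D ((z + s *\<^sub>R u) + 0 *\<^sub>R v) =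
       (h - 0) * frechet_derivative D (at ((z + s *\<^sub>R u) + t *\<^sub>R v)) v"
    using MVT2[OF \<open>h > 0\<close>, of "\<lambda>t. D ((z + s *\<^sub>R u) + t *\<^sub>R v)"
        "\<lambda>t. frechet_derivative D (at ((z + s *\<^sub>R u) + t *\<^sub>R v)) v"] by auto
  have "f (z + h *\<^sub>R u + h *\<^sub>R v) - f (z + h *\<^sub>R u) - f (z + h *\<^sub>R v) + f z = \<phi> h - \<phi> 0"
    by (simp add: \<phi>_def algebra_simps)
  also have "\<dots> = h * (h * frechet_derivative D (at (z + s *\<^sub>R u + t *\<^sub>R v)) v)"
    using s(3) t(3) by (simp add: algebra_simps)
  finally show ?thesis
    using that[of s t] s t unfolding D_def by simp
qed

text \<open>If the two mixed derivatives differed at \<open>z\<close>, then by continuity they would take disjoint sets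
  of values near \<open>z\<close>.  But the second difference over a parallelogram close to \<open>z\<close> is
  \<open>h\<^sup>2\<close> times a value of either.\<close>

lemma mixed_derivatives_commute:
  fixes f :: "'a::euclidean_space \<Rightarrow> real"
  assumes "open S" "smooth_on S f" "z \<in> S"
  shows "frechet_derivative (\<lambda>x. frechet_derivative f (at x) u) (at z) v =
         frechet_derivative (\<lambda>x. frechet_derivative f (at x) v) (at z) u"
proof (rule ccontr)
  define D where "D u v x = frechet_derivative (\<lambda>x. frechet_derivative f (at x) u) (at x) v" for u v x
  assume "\<not> ?thesis"
  then have ne: "D u v z \<noteq> D v u z" by (simp add: D_def)
  define e where "e = \<bar>D u v z - D v u z\<bar> / 2"
  have "e > 0" using ne by (simp add: e_def)
  have cont: "continuous_on S (D u v)" for u v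
    unfolding D_def by (intro smooth_on_continuous smooth_on_deriv assms)
  obtain r0 where r0: "r0 > 0" "ball z r0 \<subseteq> S"
    using assms openE by blast
  obtain r1 where r1: "r1 > 0" "\<And>x. x \<in> S \<Longrightarrow> dist x z < r1 \<Longrightarrow> dist (D u v x) (D u v z) < e"
    using cont[of u v] \<open>e > 0\<close> \<open>z \<in> S\<close> unfolding continuous_on_iff by metis
  obtain r2 where r2: "r2 > 0" "\<And>x. x \<in> S \<Longrightarrow> dist x z < r2 \<Longrightarrow> dist (D v u x) (D v u z) < e"
    using cont[of v u] \<open>e > 0\<close> \<open>z \<in> S\<close> unfolding continuous_on_iff by metis
  define r where "r = min r0 (min r1 r2)"
  have "r > 0" using r0 r1 r2 by (simp add: r_def)
  define h where "h = r / (2 * (norm u + norm v + 1))"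
  have pos: "norm u + norm v + 1 > 0" by (smt (verit) norm_ge_zero)
  have "h > 0" using \<open>r > 0\<close> pos by (simp add: h_def)
  have near: "dist (z + s *\<^sub>R a + t *\<^sub>R b) z < r"
    if "0 \<le> s" "s \<le> h" "0 \<le> t" "t \<le> h" "norm a + norm b = norm u + norm v" for s t a b
  proof -
    have "dist (z + s *\<^sub>R a + t *\<^sub>R b) z = norm (s *\<^sub>R a + t *\<^sub>R b)"
      by (simp add: dist_norm algebra_simps)
    also have "\<dots> \<le> s * norm a + t * norm b"
      using norm_triangle_ineq[of "s *\<^sub>R a" "t *\<^sub>R b"] that by simp
    also have "\<dots> \<le> h * norm a + h * norm b"
      using that by (intro add_mono mult_right_mono) auto
    also have "\<dots> = h * (norm u + norm v)"
      using that(5) by (metis distrib_left)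
    also have "\<dots> < h * (2 * (norm u + norm v + 1))"
      using \<open>h > 0\<close> pos by (intro mult_strict_left_mono) (auto simp: add_nonneg_pos)
    also have "\<dots> = r" using pos by (simp add: h_def)
    finally show ?thesis .
  qed
  have inS: "x \<in> S" if "dist x z < r" for x
    using that r0 by (auto simp: r_def dist_commute)
  obtain s t where st: "0 \<le> s" "s \<le> h" "0 \<le> t" "t \<le> h"
    "f (z + h *\<^sub>R u + h *\<^sub>R v) - f (z + h *\<^sub>R u) - f (z + h *\<^sub>R v) + f z =
     h * (h * D u v (z + s *\<^sub>R u + t *\<^sub>R v))"
    unfolding D_def
    by (rule second_difference_mean_value[OF assms(2) \<open>h > 0\<close>, of z u v]) (auto intro: inS near)
  obtain s' t' where st': "0 \<le> s'" "s' \<le> h" "0 \<le> t'" "t' \<le> h"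
    "f (z + h *\<^sub>R v + h *\<^sub>R u) - f (z + h *\<^sub>R v) - f (z + h *\<^sub>R u) + f z =
     h * (h * D v u (z + s' *\<^sub>R v + t' *\<^sub>R u))"
    unfolding D_def
    by (rule second_difference_mean_value[OF assms(2) \<open>h > 0\<close>, of z v u])
      (assumption | rule inS near[of _ _ v u] add.commute)+
  have "h * (h * D u v (z + s *\<^sub>R u + t *\<^sub>R v)) = h * (h * D v u (z + s' *\<^sub>R v + t' *\<^sub>R u))"
    using st(5) st'(5) by (simp add: algebra_simps)
  then have "D u v (z + s *\<^sub>R u + t *\<^sub>R v) = D v u (z + s' *\<^sub>R v + t' *\<^sub>R u)"
    using \<open>h > 0\<close> by simp
  moreover have "dist (D u v (z + s *\<^sub>R u + t *\<^sub>R v)) (D u v z) < e"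
    using near[of s t u v] st(1-4) by (intro r1 inS) (auto simp: r_def)
  moreover have "dist (D v u (z + s' *\<^sub>R v + t' *\<^sub>R u)) (D v u z) < e"
    using near[of s' t' v u] st'(1-4) by (intro r2 inS) (auto simp: r_def)
  ultimately show False
    unfolding e_def dist_real_def by (smt (verit) field_sum_of_halves)
qed

section \<open>Homogeneous functions on conical regions\<close>

locale cone_region =
  fixes W :: "((real^'n::finite) \<times> (real^'n)) set"
  assumes open_W: "open W"
    and cone_W: "\<And>x y t. (x, y) \<in> W \<Longrightarrow> t > 0 \<Longrightarrow> (x, t *\<^sub>R y) \<in> W"
    and nonzero_W: "\<And>x y. (x, y) \<in> W \<Longrightarrow> y \<noteq> 0"
begin

lemma homogeneousD:
  "loc_pos_homogeneous W d f \<Longrightarrow> (x, y) \<in> W \<Longrightarrow> t > 0 \<Longrightarrow> f (x, t *\<^sub>R y) = t ^ d *\<^sub>R f (x, y)"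
  by (auto simp: loc_pos_homogeneous_def)

lemma homogeneousI:
  fixes f :: "(real^'n) \<times> (real^'n) \<Rightarrow> real"
  assumes "\<And>x y t. (x, y) \<in> W \<Longrightarrow> t > 0 \<Longrightarrow> f (x, t *\<^sub>R y) = t ^ d * f (x, y)"
  shows "loc_pos_homogeneous W d f"
  using assms by (auto simp: loc_pos_homogeneous_def)

lemma frechet_derivative_cong:
  assumes "\<And>w. w \<in> W \<Longrightarrow> f w = g w" "z \<in> W" "g differentiable (at z)"
  shows "frechet_derivative f (at z) = frechet_derivative g (at z)"
  using frechet_derivative_transform_within_open[OF assms(3) open_W assms(2), of f] assms(1)
  by simp

text \<open>Both sides are the derivative of \<open>(x, y) \<mapsto> f (x, t y) = t\<^sup>d f (x, y)\<close>.  Derivatives in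
  \<open>x\<close> thus keep the degree of homogeneity (take \<open>v = 0\<close>), and derivatives in \<open>y\<close> lower it by one.\<close>

lemma derivative_homogeneous:
  fixes f :: "(real^'n) \<times> (real^'n) \<Rightarrow> real"
  assumes "smooth_on W f" "loc_pos_homogeneous W d f" "(x, y) \<in> W" "t > 0"
  shows "frechet_derivative f (at (x, t *\<^sub>R y)) (u, t *\<^sub>R v) = t ^ d * frechet_derivative f (at (x, y)) (u, v)"
proof -
  define M where "M = (\<lambda>z :: (real^'n) \<times> (real^'n). (fst z, t *\<^sub>R snd z))"
  have M: "(M has_derivative M) (at (x, y))"
    unfolding M_def by (auto intro!: derivative_eq_intros)
  have in_W: "M (x, y) \<in> W" using cone_W assms(3,4) by (simp add: M_def)
  have 1: "((\<lambda>z. f (M z)) has_derivative (\<lambda>h. frechet_derivative f (at (M (x, y))) (M h))) (at (x, y))"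
    using diff_chain_at[OF M smooth_on_has_derivative[OF assms(1) in_W]] by (simp add: o_def)
  have "((\<lambda>z. t ^ d * f z) has_derivative (\<lambda>h. t ^ d * frechet_derivative f (at (x, y)) h)) (at (x, y))"
    by (intro has_derivative_mult_right smooth_on_has_derivative[of W] assms)
  then have 2: "((\<lambda>z. f (M z)) has_derivative (\<lambda>h. t ^ d * frechet_derivative f (at (x, y)) h)) (at (x, y))"
    by (rule has_derivative_transform_within_open[OF _ open_W assms(3)])
      (use homogeneousD[OF assms(2) _ assms(4)] in \<open>auto simp: M_def\<close>)
  show ?thesis
    using fun_cong[OF has_derivative_unique[OF 1 2], of "(u, v)"] by (simp add: M_def)
qed

text \<open>Euler's relation: the derivative of \<open>t \<mapsto> f (x, t y)\<close> at \<open>t = 1\<close>.\<close>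

lemma euler:
  fixes f :: "(real^'n) \<times> (real^'n) \<Rightarrow> real"
  assumes "smooth_on W f" "loc_pos_homogeneous W d f" "z \<in> W"
  shows "frechet_derivative f (at z) (0, snd z) = d * f z"
proof -
  obtain x y where z: "z = (x, y)" by (cases z)
  have line: "((\<lambda>t. (x, t *\<^sub>R y)) has_derivative (\<lambda>t. (0, t *\<^sub>R y))) (at (1::real))"
    by (auto intro!: derivative_eq_intros)
  have "(f has_derivative frechet_derivative f (at z)) (at (x, 1 *\<^sub>R y))"
    using smooth_on_has_derivative[OF assms(1,3)] by (simp add: z)
  from diff_chain_at[OF line this]
  have 1: "((\<lambda>t. f (x, t *\<^sub>R y)) has_derivative (\<lambda>t. frechet_derivative f (at z) (0, t *\<^sub>R y))) (at 1)"
    by (simp add: o_def)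
  have "((\<lambda>t. t ^ d * f z) has_derivative (\<lambda>t. (d * t) * f z)) (at (1::real))"
    by (auto intro!: derivative_eq_intros)
  then have 2: "((\<lambda>t. f (x, t *\<^sub>R y)) has_derivative (\<lambda>t. (d * t) * f z)) (at 1)"
    by (rule has_derivative_transform_within_open[of _ _ _ _ "{0<..}"])
      (use homogeneousD[OF assms(2)] assms(3) z in auto)
  show ?thesis
    using fun_cong[OF has_derivative_unique[OF 1 2], of 1] by (simp add: z)
qed

lemma smooth_dx: "smooth_on W f \<Longrightarrow> smooth_on W (dx k f)"
  using smooth_on_deriv[of W f "(axis k 1, 0)"] by (simp add: dx_def[abs_def])

lemma smooth_dy: "smooth_on W f \<Longrightarrow> smooth_on W (dy k f)"
  using smooth_on_deriv[of W f "(0, axis k 1)"] by (simp add: dy_def[abs_def])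

lemma homogeneous_dy:
  assumes "smooth_on W f" "loc_pos_homogeneous W (Suc d) f"
  shows "loc_pos_homogeneous W d (dy k f)"
proof (rule homogeneousI)
  fix x y and t :: real assume xy: "(x, y) \<in> W" and "t > 0"
  have lin: "linear (frechet_derivative f (at (x, t *\<^sub>R y)))"
    using assms(1) cone_W[OF xy \<open>t > 0\<close>]
    by (intro linear_frechet_derivative smooth_on_imp_differentiable[of W])
  have "t * frechet_derivative f (at (x, t *\<^sub>R y)) (0, axis k 1) =
      frechet_derivative f (at (x, t *\<^sub>R y)) (0, t *\<^sub>R axis k 1)"
    using linear_scale[OF lin, of t "(0, axis k 1)"] by simp
  also have "\<dots> = t ^ Suc d * frechet_derivative f (at (x, y)) (0, axis k 1)"
    using assms xy \<open>t > 0\<close> by (rule derivative_homogeneous)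
  finally show "dy k f (x, t *\<^sub>R y) = t ^ d * dy k f (x, y)"
    using \<open>t > 0\<close> by (simp add: dy_def)
qed

lemma pair_expansion: "(u, v) = (\<Sum>j\<in>UNIV. u $ j *\<^sub>R (axis j 1, 0)) + (\<Sum>j\<in>UNIV. v $ j *\<^sub>R (0, axis j 1))"
  for u v :: "real^'n"
proof -
  have "(\<Sum>j\<in>UNIV. u $ j *\<^sub>R axis j 1) = u" for u :: "real^'n"
    using basis_expansion[of u] by (simp add: scalar_mult_eq_scaleR)
  then show ?thesis
    by (simp add: prod_eq_iff fst_sum snd_sum)
qed

lemma derivative_expansion:
  fixes f :: "(real^'n) \<times> (real^'n) \<Rightarrow> real"
  assumes "f differentiable (at z)"
  shows "frechet_derivative f (at z) (u, v) =
    (\<Sum>j\<in>UNIV. u $ j * dx j f z) + (\<Sum>j\<in>UNIV. v $ j * dy j f z)"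
proof -
  have lin: "linear (frechet_derivative f (at z))"
    using assms by (rule linear_frechet_derivative)
  show ?thesis
    by (subst pair_expansion)
      (simp only: linear_add[OF lin] linear_sum[OF lin] linear_scale[OF lin] dx_def dy_def
        real_scaleR_def)
qed

lemma derivative_add:
  fixes f g :: "(real^'n) \<times> (real^'n) \<Rightarrow> real"
  assumes "smooth_on W f" "smooth_on W g" "z \<in> W"
  shows "frechet_derivative (\<lambda>w. f w + g w) (at z) v =
    frechet_derivative f (at z) v + frechet_derivative g (at z) v"
  by (rule fun_cong[OF frechet_derivative_eqI]) (intro has_derivative_add smooth_on_has_derivative[of W] assms)

lemma derivative_diff:
  fixes f g :: "(real^'n) \<times> (real^'n) \<Rightarrow> real"
  assumes "smooth_on W f" "smooth_on W g" "z \<in> W"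
  shows "frechet_derivative (\<lambda>w. f w - g w) (at z) v =
    frechet_derivative f (at z) v - frechet_derivative g (at z) v"
  by (rule fun_cong[OF frechet_derivative_eqI]) (intro has_derivative_diff smooth_on_has_derivative[of W] assms)

lemma derivative_mult:
  fixes f g :: "(real^'n) \<times> (real^'n) \<Rightarrow> real"
  assumes "smooth_on W f" "smooth_on W g" "z \<in> W"
  shows "frechet_derivative (\<lambda>w. f w * g w) (at z) v =
    f z * frechet_derivative g (at z) v + frechet_derivative f (at z) v * g z"
  by (rule fun_cong[OF frechet_derivative_eqI]) (intro has_derivative_mult smooth_on_has_derivative[of W] assms)

lemma derivative_sum:
  fixes f :: "'i \<Rightarrow> (real^'n) \<times> (real^'n) \<Rightarrow> real"
  assumes "\<And>i. i \<in> I \<Longrightarrow> smooth_on W (f i)" "z \<in> W"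
  shows "frechet_derivative (\<lambda>w. \<Sum>i\<in>I. f i w) (at z) v =
    (\<Sum>i\<in>I. frechet_derivative (f i) (at z) v)"
  by (rule fun_cong[OF frechet_derivative_eqI]) (intro has_derivative_sum smooth_on_has_derivative[of W] assms)

lemma smooth_snd_nth: "smooth_on W (\<lambda>w. snd w $ i)"
  by (intro smooth_on_linear bounded_linear_compose[OF bounded_linear_vec_nth bounded_linear_snd])

lemma derivative_snd_nth: "frechet_derivative (\<lambda>w :: (real^'n) \<times> (real^'n). snd w $ i) (at z) v = snd v $ i"
  by (rule fun_cong[OF frechet_derivative_eqI])
    (intro bounded_linear_imp_has_derivative bounded_linear_compose[OF bounded_linear_vec_nth bounded_linear_snd])

text \<open>Collected for use with \<open>intro\<close>, which decomposes a coordinate expression into the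
  functions whose smoothness is known.\<close>

lemmas smooth_intros = open_W smooth_on_add smooth_on_diff smooth_on_mult smooth_on_sum
  smooth_on_power2 smooth_on_const smooth_snd_nth smooth_dx smooth_dy

end

section \<open>The derivation along a spray\<close>

text \<open>The spray is the vector field \<open>(y, - 2 G)\<close>, and this is its action on functions.  It is
  \<open>f \<mapsto> f\<^sub>;\<^sub>0\<close>, but being visibly a derivation that is defined without sums over indices
  and without the connection, it is the better form for calculations.\<close>

definition spray_derivative :: "'n::finite coeffs \<Rightarrow> ((real^'n) \<times> (real^'n) \<Rightarrow> real) \<Rightarrow>
    (real^'n) \<times> (real^'n) \<Rightarrow> real" where
  "spray_derivative G f z = frechet_derivative f (at z) (snd z, - 2 *\<^sub>R G z)"

locale local_spray = cone_region W for W :: "((real^'n::finite) \<times> (real^'n)) set" +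
  fixes G :: "'n coeffs"
  assumes smooth_G: "\<And>i. smooth_on W (\<lambda>w. G w $ i)"
    and homogeneous_G: "loc_pos_homogeneous W 2 G"
begin

lemma homogeneous_G_nth: "loc_pos_homogeneous W (Suc (Suc 0)) (\<lambda>w. G w $ i)"
  using homogeneousD[OF homogeneous_G] by (intro homogeneousI) (simp add: power2_eq_square)

lemma homogeneous_conn1: "loc_pos_homogeneous W (Suc 0) (dy k (\<lambda>w. G w $ i))"
  by (intro homogeneous_dy smooth_G homogeneous_G_nth)

lemma spray_derivative_sum:
  assumes "smooth_on W f" "z \<in> W"
  shows "spray_derivative G f z =
    (\<Sum>j\<in>UNIV. snd z $ j * dx j f z) - 2 * (\<Sum>j\<in>UNIV. G z $ j * dy j f z)"
  unfolding spray_derivative_def derivative_expansion[OF smooth_on_imp_differentiable[OF assms]]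
  by (simp add: sum_distrib_left sum_negf mult.assoc)

lemma smooth_spray_derivative:
  assumes "smooth_on W f"
  shows "smooth_on W (spray_derivative G f)"
proof -
  have "smooth_on W (\<lambda>z. (\<Sum>j\<in>UNIV. snd z $ j * dx j f z) - 2 * (\<Sum>j\<in>UNIV. G z $ j * dy j f z))"
    by (intro smooth_intros smooth_G assms)
  then show ?thesis
    using smooth_on_cong[OF open_W spray_derivative_sum[OF assms]] by simp
qed

lemma homogeneous_spray_derivative:
  assumes "smooth_on W f" "loc_pos_homogeneous W d f"
  shows "loc_pos_homogeneous W (Suc d) (spray_derivative G f)"
proof (rule homogeneousI)
  fix x y and t :: real assume xy: "(x, y) \<in> W" and "t > 0"
  have lin: "linear (frechet_derivative f (at (x, t *\<^sub>R y)))"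
    using assms(1) cone_W[OF xy \<open>t > 0\<close>]
    by (intro linear_frechet_derivative smooth_on_imp_differentiable[of W])
  have "(t *\<^sub>R y, - 2 *\<^sub>R G (x, t *\<^sub>R y)) = t *\<^sub>R (y, t *\<^sub>R (- 2 *\<^sub>R G (x, y)))"
    using homogeneousD[OF homogeneous_G xy \<open>t > 0\<close>] by (simp add: power2_eq_square)
  then have "spray_derivative G f (x, t *\<^sub>R y) =
      t * frechet_derivative f (at (x, t *\<^sub>R y)) (y, t *\<^sub>R (- 2 *\<^sub>R G (x, y)))"
    unfolding spray_derivative_def snd_conv using linear_scale[OF lin] by (simp only: real_scaleR_def)
  also have "frechet_derivative f (at (x, t *\<^sub>R y)) (y, t *\<^sub>R (- 2 *\<^sub>R G (x, y))) =
      t ^ d * frechet_derivative f (at (x, y)) (y, - 2 *\<^sub>R G (x, y))"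
    using assms xy \<open>t > 0\<close> by (rule derivative_homogeneous)
  finally show "spray_derivative G f (x, t *\<^sub>R y) = t ^ Suc d * spray_derivative G f (x, y)"
    by (simp add: spray_derivative_def)
qed

lemma euler_dy:
  assumes "smooth_on W f" "loc_pos_homogeneous W d f" "z \<in> W"
  shows "(\<Sum>j\<in>UNIV. snd z $ j * dy j f z) = d * f z"
  using euler[OF assms] derivative_expansion[OF smooth_on_imp_differentiable[OF assms(1,3)], of 0 "snd z"]
  by simp

lemma euler_conn1: "z \<in> W \<Longrightarrow> (\<Sum>j\<in>UNIV. snd z $ j * dy j (\<lambda>w. G w $ i) z) = 2 * G z $ i"
  using euler_dy[OF smooth_G homogeneous_G_nth, of z i] by simp

lemma euler_conn2:
  "z \<in> W \<Longrightarrow> (\<Sum>j\<in>UNIV. snd z $ j * dy j (dy k (\<lambda>w. G w $ i)) z) = dy k (\<lambda>w. G w $ i) z"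
  using euler_dy[OF smooth_dy[OF smooth_G] homogeneous_conn1, of z k i] by simp

text \<open>The two sums with second derivatives are the spray derivation applied to \<open>G\<^sup>i\<^sub>k\<close>.\<close>

lemma riemann_spray_derivative:
  assumes "z \<in> W"
  shows "riemann G i k z = 2 * dx k (\<lambda>w. G w $ i) z - spray_derivative G (dy k (\<lambda>w. G w $ i)) z
    - (\<Sum>j\<in>UNIV. dy j (\<lambda>w. G w $ i) z * dy k (\<lambda>w. G w $ j) z)"
  unfolding riemann_def spray_derivative_sum[OF smooth_dy[OF smooth_G] assms] by simp

text \<open>Contracting \<open>G\<^sup>r\<^sub>k\<close> with \<open>y\<^sup>k\<close> gives \<open>2 G\<^sup>r\<close>, by Euler's relation.\<close>

lemma hor_0_eq:
  assumes "smooth_on W f" "z \<in> W"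
  shows "hor_0 G f z = spray_derivative G f z"
proof -
  have "(\<Sum>k\<in>UNIV. (\<Sum>r\<in>UNIV. dy k (\<lambda>w. G w $ r) z * dy r f z) * snd z $ k) =
      (\<Sum>r\<in>UNIV. (\<Sum>k\<in>UNIV. snd z $ k * dy k (\<lambda>w. G w $ r) z) * dy r f z)"
    unfolding sum_distrib_right by (subst sum.swap) (simp add: ac_simps)
  also have "\<dots> = (\<Sum>r\<in>UNIV. 2 * G z $ r * dy r f z)"
    using euler_conn1[OF assms(2)] by simp
  finally have eq: "(\<Sum>k\<in>UNIV. (\<Sum>r\<in>UNIV. dy k (\<lambda>w. G w $ r) z * dy r f z) * snd z $ k) =
      2 * (\<Sum>r\<in>UNIV. G z $ r * dy r f z)"
    by (simp add: sum_distrib_left mult.assoc)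
  have "hor_0 G f z = (\<Sum>k\<in>UNIV. snd z $ k * dx k f z)
      - (\<Sum>k\<in>UNIV. (\<Sum>r\<in>UNIV. dy k (\<lambda>w. G w $ r) z * dy r f z) * snd z $ k)"
    by (simp add: hor_0_def delta_def conn1_def left_diff_distrib sum_subtractf)
      (simp add: mult.commute)
  then show ?thesis
    using eq spray_derivative_sum[OF assms] by simp
qed

text \<open>Contracting \<open>G\<^sup>r\<^sub>k\<^sub>j\<close> with \<open>y\<^sup>j\<close> gives \<open>G\<^sup>r\<^sub>k\<close>, since \<open>G\<^sup>r\<^sub>k\<close> has degree one.\<close>

lemma dot_hor_0_eq:
  assumes "smooth_on W f" "z \<in> W"
  shows "dot_hor_0 G k f z =
    spray_derivative G (dy k f) z - (\<Sum>r\<in>UNIV. dy r f z * dy k (\<lambda>w. G w $ r) z)"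
proof -
  have "(\<Sum>j\<in>UNIV. (\<Sum>r\<in>UNIV. dy r f z * dy j (dy k (\<lambda>w. G w $ r)) z) * snd z $ j) =
      (\<Sum>r\<in>UNIV. dy r f z * (\<Sum>j\<in>UNIV. snd z $ j * dy j (dy k (\<lambda>w. G w $ r)) z))"
    unfolding sum_distrib_right sum_distrib_left by (subst sum.swap) (simp add: ac_simps)
  also have "\<dots> = (\<Sum>r\<in>UNIV. dy r f z * dy k (\<lambda>w. G w $ r) z)"
    using euler_conn2[OF assms(2)] by simp
  finally show ?thesis
    using hor_0_eq[OF smooth_dy[OF assms(1)] assms(2), of k]
    by (simp add: dot_hor_0_def dot_hor_def conn2_def hor_0_def left_diff_distrib sum_subtractf)
qed

text \<open>A vertical derivative is moved past the spray derivation by the symmetry of second derivatives.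
  The terms in which it falls on the coefficients \<open>y\<close> and \<open>- 2 G\<close> complete the two covariant
  derivatives.\<close>

lemma dy_spray_derivative:
  assumes "smooth_on W f" "z \<in> W"
  shows "dy k (spray_derivative G f) z = delta G k f z + dot_hor_0 G k f z"
proof -
  note sm = smooth_intros smooth_G assms(1)
  have cong: "dy k (spray_derivative G f) z =
      dy k (\<lambda>z. (\<Sum>j\<in>UNIV. snd z $ j * dx j f z) - 2 * (\<Sum>j\<in>UNIV. G z $ j * dy j f z)) z"
    unfolding dy_def[of k]
    by (rule fun_cong[OF frechet_derivative_cong])
      (use assms spray_derivative_sum in \<open>auto intro!: smooth_on_imp_differentiable[of W] sm\<close>)
  have dyx: "dy k (dx j f) z = dx j (dy k f) z" for j
    unfolding dx_def dy_def using open_W assms by (rule mixed_derivatives_commute)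
  have dyy: "dy k (dy j f) z = dy j (dy k f) z" for j
    unfolding dx_def dy_def using open_W assms by (rule mixed_derivatives_commute)
  have 1: "dy k (\<lambda>z. snd z $ j * dx j f z) z = snd z $ j * dx j (dy k f) z + (if j = k then 1 else 0) * dx j f z" for j
  proof -
    have "dy k (\<lambda>z. snd z $ j * dx j f z) z = snd z $ j * dy k (dx j f) z + dy k (\<lambda>z. snd z $ j) z * dx j f z"
      unfolding dy_def[of k] by (intro derivative_mult sm assms)
    then show ?thesis by (simp add: dyx) (simp add: dy_def derivative_snd_nth axis_def)
  qed
  have 2: "dy k (\<lambda>z. G z $ j * dy j f z) z = G z $ j * dy j (dy k f) z + dy k (\<lambda>w. G w $ j) z * dy j f z" for j
  proof -
    have "dy k (\<lambda>z. G z $ j * dy j f z) z = G z $ j * dy k (dy j f) z + dy k (\<lambda>w. G w $ j) z * dy j f z"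
      unfolding dy_def[of k] by (intro derivative_mult sm assms)
    then show ?thesis by (simp add: dyy)
  qed
  have "dy k (\<lambda>z. (\<Sum>j\<in>UNIV. snd z $ j * dx j f z) - 2 * (\<Sum>j\<in>UNIV. G z $ j * dy j f z)) z =
      dy k (\<lambda>z. \<Sum>j\<in>UNIV. snd z $ j * dx j f z) z - dy k (\<lambda>z. 2 * (\<Sum>j\<in>UNIV. G z $ j * dy j f z)) z"
    unfolding dy_def[of k] by (intro derivative_diff sm assms)
  also have "dy k (\<lambda>z. 2 * (\<Sum>j\<in>UNIV. G z $ j * dy j f z)) z = 2 * dy k (\<lambda>z. \<Sum>j\<in>UNIV. G z $ j * dy j f z) z"
    unfolding dy_def[of k] by (subst derivative_mult) (auto intro!: sm assms)
  also have "dy k (\<lambda>z. \<Sum>j\<in>UNIV. snd z $ j * dx j f z) z = (\<Sum>j\<in>UNIV. dy k (\<lambda>z. snd z $ j * dx j f z) z)"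
    unfolding dy_def[of k] by (intro derivative_sum sm assms)
  also have "dy k (\<lambda>z. \<Sum>j\<in>UNIV. G z $ j * dy j f z) z = (\<Sum>j\<in>UNIV. dy k (\<lambda>z. G z $ j * dy j f z) z)"
    unfolding dy_def[of k] by (intro derivative_sum sm assms)
  finally show ?thesis
    unfolding cong dot_hor_0_eq[OF assms] spray_derivative_sum[OF smooth_dy[OF assms(1)] assms(2)]
    by (simp add: 1 2 sum.distrib delta_def conn1_def if_distrib[of "\<lambda>a. a * _"] cong: if_cong)
      (simp add: algebra_simps)
qed

end

section \<open>The curvature of projectively related sprays\<close>

text \<open>A nonzero multiple of the identity matrix has rank at least two, the matrix on the right at most
  one.\<close>

lemma identity_eq_rank_one:
  fixes y :: "real^'n::finite"
  assumes "CARD('n) \<ge> 2" "y \<noteq> 0" and eq: "\<And>i k. (if i = k then a else 0) = b k * y $ i"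
  shows "a = 0" "b k = 0"
proof -
  obtain i where i: "y $ i \<noteq> 0" using assms(2) by (auto simp: vec_eq_iff)
  obtain j where j: "j \<noteq> i"
    using assms(1) by (metis One_nat_def card_2_iff' card_le_Suc0_iff_eq finite iso_tuple_UNIV_I not_less_eq_eq numeral_2_eq_2)
  have "b j = 0" using eq[of i j] i j by simp
  then show "a = 0" using eq[of j j] by simp
  then show "b k = 0" using eq[of i k] i by (simp split: if_splits)
qed

locale projective_pair = local_spray W G for W :: "((real^'n::finite) \<times> (real^'n)) set" and G +
  fixes Gbar :: "'n coeffs" and P :: "(real^'n) \<times> (real^'n) \<Rightarrow> real"
  assumes spray_Gbar: "local_spray W Gbar"
    and smooth_P: "smooth_on W P"
    and homogeneous_P: "loc_pos_homogeneous W (Suc 0) P"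
    and Gbar_eq: "\<And>z. z \<in> W \<Longrightarrow> Gbar z = G z + P z *\<^sub>R snd z"
begin

text \<open>In index notation \<open>xi\<close> is \<open>P\<^sup>2 - P\<^sub>;\<^sub>0\<close> and \<open>tau k\<close> is \<open>2 P\<^sub>;\<^sub>k - P\<^sub>.\<^sub>k\<^sub>;\<^sub>0 - P P\<^sub>.\<^sub>k\<close>: the
  coefficients of \<open>\<delta>\<^sup>i\<^sub>k\<close> and of \<open>y\<^sup>i\<close> in the change of the Riemann curvature.\<close>

definition xi :: "(real^'n) \<times> (real^'n) \<Rightarrow> real" where
  "xi z = (P z)\<^sup>2 - spray_derivative G P z"

definition tau :: "'n \<Rightarrow> (real^'n) \<times> (real^'n) \<Rightarrow> real" where
  "tau k z = 2 * delta G k P z - dot_hor_0 G k P z - P z * dy k P z"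

lemma smooth_xi: "smooth_on W xi"
  using smooth_on_diff[OF open_W smooth_on_power2[OF open_W smooth_P] smooth_spray_derivative[OF smooth_P]]
  by (simp add: xi_def[abs_def])

lemma homogeneous_xi: "loc_pos_homogeneous W 2 xi"
  using homogeneousD[OF homogeneous_P]
    homogeneousD[OF homogeneous_spray_derivative[OF smooth_P homogeneous_P]]
  by (intro homogeneousI) (simp add: xi_def power2_eq_square algebra_simps)

lemma derivative_Gbar:
  assumes "z \<in> W"
  shows "frechet_derivative (\<lambda>w. Gbar w $ i) (at z) v =
    frechet_derivative (\<lambda>w. G w $ i) (at z) v + P z * snd v $ i + frechet_derivative P (at z) v * snd z $ i"
proof -
  have "frechet_derivative (\<lambda>w. Gbar w $ i) (at z) v = frechet_derivative (\<lambda>w. G w $ i + P w * snd w $ i) (at z) v"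
    by (rule fun_cong[OF frechet_derivative_cong])
      (auto simp: Gbar_eq assms intro!: smooth_on_imp_differentiable[of W] smooth_intros smooth_G smooth_P assms)
  also have "\<dots> = frechet_derivative (\<lambda>w. G w $ i) (at z) v + frechet_derivative (\<lambda>w. P w * snd w $ i) (at z) v"
    by (intro derivative_add smooth_intros smooth_G smooth_P assms)
  also have "frechet_derivative (\<lambda>w. P w * snd w $ i) (at z) v =
      P z * frechet_derivative (\<lambda>w :: (real^'n) \<times> (real^'n). snd w $ i) (at z) v +
      frechet_derivative P (at z) v * snd z $ i"
    by (intro derivative_mult smooth_intros smooth_G smooth_P assms)
  finally show ?thesis by (simp add: derivative_snd_nth)
qed

lemma dx_Gbar: "z \<in> W \<Longrightarrow> dx k (\<lambda>w. Gbar w $ i) z = dx k (\<lambda>w. G w $ i) z + dx k P z * snd z $ i"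
  by (simp add: dx_def derivative_Gbar)

lemma dy_Gbar: "z \<in> W \<Longrightarrow> dy k (\<lambda>w. Gbar w $ i) z =
    dy k (\<lambda>w. G w $ i) z + (P z * (if i = k then 1 else 0) + dy k P z * snd z $ i)"
  by (simp add: dy_def derivative_Gbar axis_def)

text \<open>The two sprays differ by \<open>- 2 P\<close> times the vertical radial field, and that field multiplies
  a function of degree \<open>d\<close> by \<open>d\<close>.\<close>

lemma spray_derivative_Gbar:
  assumes "smooth_on W f" "loc_pos_homogeneous W d f" "z \<in> W"
  shows "spray_derivative Gbar f z = spray_derivative G f z - 2 * P z * (d * f z)"
proof -
  have lin: "linear (frechet_derivative f (at z))"
    using assms(1,3) by (intro linear_frechet_derivative smooth_on_imp_differentiable[of W])
  have "(snd z, - 2 *\<^sub>R Gbar z) = (snd z, - 2 *\<^sub>R G z) + (- 2 * P z) *\<^sub>R (0, snd z)"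
    using assms(3) by (simp add: Gbar_eq algebra_simps)
  then have "spray_derivative Gbar f z = spray_derivative G f z + (- 2 * P z) * frechet_derivative f (at z) (0, snd z)"
    unfolding spray_derivative_def by (simp only: linear_add[OF lin] linear_scale[OF lin] real_scaleR_def)
  then show ?thesis using euler[OF assms] by simp
qed

lemma spray_derivative_dy_Gbar:
  assumes "z \<in> W"
  shows "spray_derivative G (dy k (\<lambda>w. Gbar w $ i)) z = spray_derivative G (dy k (\<lambda>w. G w $ i)) z
    + spray_derivative G P z * (if i = k then 1 else 0)
    + (spray_derivative G (dy k P) z * snd z $ i - 2 * (dy k P z * G z $ i))"
proof -
  let ?v = "(snd z, - 2 *\<^sub>R G z)" and ?e = "if i = k then 1 else 0 :: real"
  note sm = smooth_intros smooth_G smooth_P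
  have "frechet_derivative (dy k (\<lambda>w. Gbar w $ i)) (at z) ?v =
      frechet_derivative (\<lambda>z. dy k (\<lambda>w. G w $ i) z + (P z * ?e + dy k P z * snd z $ i)) (at z) ?v"
    by (rule fun_cong[OF frechet_derivative_cong])
      (use assms in \<open>auto simp: dy_Gbar intro!: smooth_on_imp_differentiable[of W] sm\<close>)
  also have "\<dots> = frechet_derivative (dy k (\<lambda>w. G w $ i)) (at z) ?v +
      frechet_derivative (\<lambda>z. P z * ?e + dy k P z * snd z $ i) (at z) ?v"
    by (intro derivative_add sm assms)
  also have "frechet_derivative (\<lambda>z. P z * ?e + dy k P z * snd z $ i) (at z) ?v =
      frechet_derivative (\<lambda>z. P z * ?e) (at z) ?v + frechet_derivative (\<lambda>z. dy k P z * snd z $ i) (at z) ?v"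
    by (intro derivative_add sm assms)
  also have "frechet_derivative (\<lambda>z. P z * ?e) (at z) ?v =
      P z * frechet_derivative (\<lambda>_ :: (real^'n) \<times> (real^'n). ?e) (at z) ?v + frechet_derivative P (at z) ?v * ?e"
    by (intro derivative_mult sm assms)
  also have "frechet_derivative (\<lambda>z. dy k P z * snd z $ i) (at z) ?v =
      dy k P z * frechet_derivative (\<lambda>z :: (real^'n) \<times> (real^'n). snd z $ i) (at z) ?v +
      frechet_derivative (dy k P) (at z) ?v * snd z $ i"
    by (intro derivative_mult sm assms)
  finally show ?thesis
    by (simp add: spray_derivative_def derivative_snd_nth)
qed

text \<open>Insert \<open>G\<^sup>i\<^sub>k + P \<delta>\<^sup>i\<^sub>k + P\<^sub>.\<^sub>k y\<^sup>i\<close> for the connection coefficients of \<open>Gbar\<close>.  Euler's relation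
  evaluates every contraction with \<open>y\<close>; the terms \<open>P G\<^sup>i\<^sub>k\<close> and \<open>P\<^sub>.\<^sub>k G\<^sup>i\<close> cancel, and only
  multiples of \<open>\<delta>\<^sup>i\<^sub>k\<close> and \<open>y\<^sup>i\<close> are left.\<close>

lemma riemann_Gbar:
  assumes "z \<in> W"
  shows "riemann Gbar i k z = riemann G i k z + (if i = k then xi z else 0) + tau k z * snd z $ i"
proof -
  interpret Gbar: local_spray W Gbar by (rule spray_Gbar)
  note eq = dy_Gbar[OF assms] dx_Gbar[OF assms]
  let ?e = "\<lambda>i k :: 'n. if i = k then 1 else 0 :: real"
  let ?y = "\<lambda>i. snd z $ i" and ?G = "\<lambda>i k. dy k (\<lambda>w. G w $ i) z" and ?P = "\<lambda>k. dy k P z"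
  have eP: "(\<Sum>j\<in>UNIV. ?y j * ?P j) = P z"
    using euler_dy[OF smooth_P homogeneous_P assms] by simp
  have S: "spray_derivative Gbar (dy k (\<lambda>w. Gbar w $ i)) z =
     spray_derivative G (dy k (\<lambda>w. G w $ i)) z
     + spray_derivative G P z * ?e i k + (spray_derivative G (dy k P) z * ?y i - 2 * (?P k * G z $ i))
     - 2 * P z * (?G i k + (P z * ?e i k + ?P k * ?y i))"
    using spray_derivative_Gbar[OF smooth_dy[OF Gbar.smooth_G] Gbar.homogeneous_conn1 assms, of k i]
    by (simp add: spray_derivative_dy_Gbar[OF assms] eq)
  \<comment> \<open>The product of the two three-term expressions, kept as nine separate sums so that each
    can be contracted on its own.\<close>
  have "(\<Sum>j\<in>UNIV. dy j (\<lambda>w. Gbar w $ i) z * dy k (\<lambda>w. Gbar w $ j) z) =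
     (\<Sum>j\<in>UNIV. ?G i j * ?G j k) + (\<Sum>j\<in>UNIV. ?G i j * P z * ?e j k) + ?P k * (\<Sum>j\<in>UNIV. ?y j * ?G i j)
     + (\<Sum>j\<in>UNIV. P z * ?e i j * ?G j k) + (\<Sum>j\<in>UNIV. P z * ?e i j * (P z * ?e j k))
     + (\<Sum>j\<in>UNIV. P z * ?e i j * (?P k * ?y j))
     + ?y i * (\<Sum>j\<in>UNIV. ?P j * ?G j k) + (\<Sum>j\<in>UNIV. ?P j * ?y i * (P z * ?e j k))
     + ?y i * ?P k * (\<Sum>j\<in>UNIV. ?y j * ?P j)"
    unfolding eq sum_distrib_left sum.distrib[symmetric]
    by (intro sum.cong refl) (simp only: algebra_simps)
  also have "\<dots> = (\<Sum>j\<in>UNIV. ?G i j * ?G j k) + ?G i k * P z + ?P k * (2 * G z $ i)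
     + P z * ?G i k + P z * P z * ?e i k + P z * (?P k * ?y i) + ?y i * (\<Sum>j\<in>UNIV. ?P j * ?G j k)
     + ?P k * ?y i * P z + ?y i * ?P k * P z"
    unfolding eP euler_conn1[OF assms]
    by (simp add: if_distrib[of "\<lambda>a. _ * a"] if_distrib[of "\<lambda>a. a * _"] cong: if_cong)
  finally show ?thesis
    unfolding riemann_spray_derivative[OF assms] Gbar.riemann_spray_derivative[OF assms] S
      xi_def tau_def delta_def conn1_def dot_hor_0_eq[OF smooth_P assms] eq
    by (simp add: algebra_simps power2_eq_square)
qed

lemma dy_xi:
  assumes "z \<in> W"
  shows "dy k xi z = 2 * P z * dy k P z - delta G k P z - dot_hor_0 G k P z"
proof -
  have "dy k xi z = dy k (\<lambda>z. (P z)\<^sup>2) z - dy k (spray_derivative G P) z"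
    unfolding dy_def xi_def[abs_def]
    by (intro derivative_diff smooth_intros smooth_P smooth_spray_derivative assms)
  also have "dy k (\<lambda>z. (P z)\<^sup>2) z = 2 * P z * dy k P z"
    using derivative_mult[OF smooth_P smooth_P assms] by (simp add: dy_def power2_eq_square)
  finally show ?thesis by (simp add: dy_spray_derivative[OF smooth_P assms])
qed

lemma contract_delta:
  "z \<in> W \<Longrightarrow> (\<Sum>k\<in>UNIV. snd z $ k * delta G k P z) = spray_derivative G P z"
  using hor_0_eq[OF smooth_P, of z] by (simp add: hor_0_def mult.commute)

text \<open>Euler's relation for \<open>P\<^sub>;\<^sub>0\<close>, of degree two, gives
  \<open>2 P\<^sub>;\<^sub>0 = y\<^sup>k (P\<^sub>;\<^sub>0)\<^sub>.\<^sub>k = y\<^sup>k P\<^sub>;\<^sub>k + y\<^sup>k P\<^sub>.\<^sub>k\<^sub>;\<^sub>0\<close>, and the first term on the right is already \<open>P\<^sub>;\<^sub>0\<close>.\<close>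

lemma contract_dot_hor_0:
  assumes "z \<in> W"
  shows "(\<Sum>k\<in>UNIV. snd z $ k * dot_hor_0 G k P z) = spray_derivative G P z"
proof -
  have "(\<Sum>k\<in>UNIV. snd z $ k * dy k (spray_derivative G P) z) = 2 * spray_derivative G P z"
    using euler_dy[OF smooth_spray_derivative homogeneous_spray_derivative, OF smooth_P smooth_P homogeneous_P assms]
    by simp
  then show ?thesis
    using contract_delta[OF assms]
    by (simp add: dy_spray_derivative[OF smooth_P assms] distrib_left sum.distrib)
qed

lemma contract_tau:
  assumes "z \<in> W"
  shows "(\<Sum>k\<in>UNIV. tau k z * snd z $ k) = - xi z"
proof -
  have "(\<Sum>k\<in>UNIV. tau k z * snd z $ k) = 2 * (\<Sum>k\<in>UNIV. snd z $ k * delta G k P z)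
      - (\<Sum>k\<in>UNIV. snd z $ k * dot_hor_0 G k P z) - P z * (\<Sum>k\<in>UNIV. snd z $ k * dy k P z)"
    unfolding tau_def sum_distrib_left sum_subtractf[symmetric]
    by (intro sum.cong refl) (simp add: algebra_simps)
  then show ?thesis
    using euler_dy[OF smooth_P homogeneous_P assms]
    by (simp add: contract_delta[OF assms] contract_dot_hor_0[OF assms] xi_def power2_eq_square)
qed

lemma ricci_Gbar:
  assumes "z \<in> W"
  shows "ricci Gbar z = ricci G z + (real CARD('n) - 1) * xi z"
  using contract_tau[OF assms]
  by (simp add: ricci_def riemann_Gbar[OF assms] sum.distrib algebra_simps)

lemma ricci_eq_iff_weak_funk:
  assumes "CARD('n) \<ge> 2" "z \<in> W"
  shows "ricci Gbar z = ricci G z \<longleftrightarrow> hor_0 G P z = (P z)\<^sup>2"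
  using assms by (auto simp: ricci_Gbar hor_0_eq[OF smooth_P] xi_def)

lemma dy_cong:
  assumes "\<And>w. w \<in> W \<Longrightarrow> f w = g w" "smooth_on W g" "z \<in> W"
  shows "dy k f z = dy k g z"
  unfolding dy_def
  using frechet_derivative_cong[of f g z] assms smooth_on_imp_differentiable[OF assms(2,3)] by simp

text \<open>If the curvatures agree, then \<open>xi\<close> and \<open>tau\<close> vanish.  Differentiating \<open>xi = 0\<close> yields
  \<open>P\<^sub>;\<^sub>k + P\<^sub>.\<^sub>k\<^sub>;\<^sub>0 = 2 P P\<^sub>.\<^sub>k\<close>, and adding \<open>tau = 0\<close> eliminates \<open>P\<^sub>.\<^sub>k\<^sub>;\<^sub>0\<close>:
  \<open>3 P\<^sub>;\<^sub>k = 3 P P\<^sub>.\<^sub>k\<close>.  Conversely a Funk function is weak Funk, by contraction with \<open>y\<close>, so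
  \<open>xi = 0\<close>, and its vertical derivative then forces \<open>tau = 0\<close>.\<close>

lemma riemann_eq_iff_funk:
  assumes "CARD('n) \<ge> 2"
  shows "(\<forall>z\<in>W. \<forall>i k. riemann Gbar i k z = riemann G i k z) \<longleftrightarrow>
    (\<forall>z\<in>W. \<forall>k. delta G k P z = P z * dy k P z)" (is "?L \<longleftrightarrow> ?R")
proof
  assume ?L
  have rank: "(if i = k then xi z else 0) = (- tau k z) * snd z $ i" if "z \<in> W" for z i k
    using \<open>?L\<close> riemann_Gbar[OF that, of i k] that by simp
  have nz: "snd z \<noteq> 0" if "z \<in> W" for z
    using nonzero_W[of "fst z" "snd z"] that by simp
  have xi0: "xi z = 0" if "z \<in> W" for z
    using identity_eq_rank_one(1)[OF assms nz[OF that] rank[OF that]] .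
  have tau0: "tau k z = 0" if "z \<in> W" for k z
    using identity_eq_rank_one(2)[OF assms nz[OF that] rank[OF that]] by simp
  have dy0: "dy k xi z = 0" if "z \<in> W" for k z
    using dy_cong[of xi "\<lambda>_. 0" z k] xi0 that smooth_on_const[of W 0] by (simp add: dy_def)
  have "delta G k P z = P z * dy k P z" if "z \<in> W" for k z
    using dy0[OF that, of k] tau0[OF that, of k]
    unfolding dy_xi[OF that] tau_def mult.assoc by linarith
  then show ?R by blast
next
  assume funk: ?R
  have "spray_derivative G P z = P z * P z" if "z \<in> W" for z
    using contract_delta[OF that] euler_dy[OF smooth_P homogeneous_P that] funk that
    by (simp add: sum_distrib_left[symmetric] mult.left_commute)
  then have xi0: "xi z = 0" if "z \<in> W" for z
    using that by (simp add: xi_def power2_eq_square)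
  then have "dy k xi z = 0" if "z \<in> W" for k z
    using dy_cong[of xi "\<lambda>_. 0" z k] that smooth_on_const[of W 0] by (simp add: dy_def)
  then have "tau k z = 0" if "z \<in> W" for k z
    using funk that by (auto simp: dy_xi tau_def)
  with xi0 show ?L by (simp add: riemann_Gbar)
qed

text \<open>This is the compatibility \<open>R\<^sub>.\<^sub>k = 2 \<tau>\<^sub>k\<close> for the change of an isotropic curvature, in which \<open>R\<close>
  increases by \<open>xi\<close> and \<open>\<tau>\<^sub>k\<close> by \<open>- tau k\<close>.\<close>

lemma hamel_imp_tau:
  assumes "\<And>k. delta G k P z = dot_hor_0 G k P z" "z \<in> W"
  shows "tau k z = - dy k xi z / 2"
  using assms(1)[of k] by (simp add: dy_xi[OF assms(2)] tau_def)

text \<open>In dimension at least two the pair \<open>(R, \<tau>)\<close> is determined by the curvature, so it changes by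
  \<open>(xi, - tau)\<close>; then \<open>xi\<^sub>.\<^sub>k = - 2 tau\<^sub>k\<close> reads \<open>3 P\<^sub>;\<^sub>k = 3 P\<^sub>.\<^sub>k\<^sub>;\<^sub>0\<close>.\<close>

lemma isotropic_imp_hamel:
  assumes G: "\<And>z i k. z \<in> W \<Longrightarrow> riemann G i k z = R z * (if i = k then 1 else 0) - T k z * snd z $ i"
    and Gbar: "\<And>z i k. z \<in> W \<Longrightarrow> riemann Gbar i k z = Rbar z * (if i = k then 1 else 0) - Tbar k z * snd z $ i"
    and T: "\<And>z k. z \<in> W \<Longrightarrow> dy k R z = 2 * T k z"
    and Tbar: "\<And>z k. z \<in> W \<Longrightarrow> dy k Rbar z = 2 * Tbar k z"
    and smooth: "smooth_on W R" "z \<in> W"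
  shows "delta G k P z = dot_hor_0 G k P z"
proof (cases "CARD('n) \<ge> 2")
  case True
  have rank: "(if i = k then Rbar w - R w - xi w else 0) = (Tbar k w - T k w + tau k w) * snd w $ i"
    if "w \<in> W" for w i k
    using riemann_Gbar[OF that, of i k] unfolding G[OF that] Gbar[OF that]
    by (auto simp: algebra_simps split: if_splits)
  have nz: "snd w \<noteq> 0" if "w \<in> W" for w
    using nonzero_W[of "fst w" "snd w"] that by simp
  have R: "Rbar w = R w + xi w" if "w \<in> W" for w
    using identity_eq_rank_one(1)[OF True nz[OF that] rank[OF that]] by simp
  have tau: "Tbar k z = T k z - tau k z"
    using identity_eq_rank_one(2)[OF True nz[OF smooth(2)] rank[OF smooth(2)], of k] by simp
  have "dy k Rbar z = dy k (\<lambda>w. R w + xi w) z"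
    by (rule dy_cong) (auto intro!: smooth_intros smooth smooth_xi R)
  also have "\<dots> = dy k R z + dy k xi z"
    unfolding dy_def by (intro derivative_add smooth smooth_xi)
  finally have "- 2 * tau k z = dy k xi z"
    using T[OF smooth(2)] Tbar[OF smooth(2)] tau by simp
  then show ?thesis by (simp add: tau_def dy_xi[OF smooth(2)])
next
  \<comment> \<open>In dimension one every \<open>P\<close> is a Hamel function: both sides have the same contraction
    with \<open>y\<close>, and that contraction has a single term.\<close>
  case False
  then have "CARD('n) = 1"
    using zero_less_card_finite[where 'a='n] by linarith
  then obtain j where "(UNIV :: 'n set) = {j}"
    by (rule card_1_singletonE)
  then have U: "(UNIV :: 'n set) = {k}"
    by (metis UNIV_I singletonD)
  have "snd z $ k * delta G k P z = snd z $ k * dot_hor_0 G k P z"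
    using contract_delta[OF smooth(2)] contract_dot_hor_0[OF smooth(2)] by (simp add: U)
  moreover have "snd z $ k \<noteq> 0"
    using nonzero_W[of "fst z" "snd z"] smooth(2) U by (auto simp: vec_eq_iff)
  ultimately show ?thesis by simp
qed

end

section \<open>Coordinates on the tangent bundle\<close>

lemma tangent_space_transition:
  "v \<in> tangent_space A p \<Longrightarrow> c \<in> A \<Longrightarrow> d \<in> A \<Longrightarrow> p \<in> fst c \<Longrightarrow> p \<in> fst d \<Longrightarrow>
    v d = frechet_derivative (transition c d) (at (snd c p)) (v c)"
  unfolding tangent_space_def by blast

lemma tangent_space_outside:
  "v \<in> tangent_space A p \<Longrightarrow> \<not> (c \<in> A \<and> p \<in> fst c) \<Longrightarrow> v c = 0"
  unfolding tangent_space_def by blast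

text \<open>A tangent vector is determined by its components in one chart, as the other components are
  obtained by the Jacobians of the transition maps or are the dummy value \<open>0\<close>.\<close>

lemma inj_on_tangent_chart:
  assumes "smooth_atlas A" "c \<in> A"
  shows "inj_on (snd (tangent_chart A c)) (fst (tangent_chart A c))"
proof (rule inj_onI)
  fix z w assume z: "z \<in> fst (tangent_chart A c)" and w: "w \<in> fst (tangent_chart A c)"
    and eq: "snd (tangent_chart A c) z = snd (tangent_chart A c) w"
  obtain p u where zp: "z = (p, u)" by (cases z)
  obtain q v where wq: "w = (q, v)" by (cases w)
  have p: "p \<in> fst c" "u \<in> tangent_space A p" and q: "q \<in> fst c" "v \<in> tangent_space A q"
    and e: "snd c p = snd c q" "u c = v c"
    using z w eq by (auto simp: tangent_chart_def zp wq)
  have "inj_on (snd c) (fst c)" using assms by (auto simp: smooth_atlas_def)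
  then have pq: "p = q" using e(1) p(1) q(1) by (auto dest: inj_onD)
  have uv: "u \<in> tangent_space A q" "v \<in> tangent_space A q"
    using p q pq by auto
  have "u d = v d" for d
  proof (cases "d \<in> A \<and> q \<in> fst d")
    case True
    then show ?thesis
      using tangent_space_transition[OF uv(1), of c d] tangent_space_transition[OF uv(2), of c d]
        q(1) assms(2) e(2) by simp
  next
    case False
    show ?thesis
      using tangent_space_outside[OF uv(1) False] tangent_space_outside[OF uv(2) False] by simp
  qed
  then show "z = w" using pq zp wq by auto
qed

lemma chart_inv_tangent_chart:
  assumes "smooth_atlas A" "c \<in> A" "p \<in> fst c" "v \<in> tangent_space A p"
  shows "chart_inv (tangent_chart A c) (snd c p, v c) = (p, v)"
proof -
  have "(p, v) \<in> fst (tangent_chart A c)" "snd (tangent_chart A c) (p, v) = (snd c p, v c)"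
    using assms by (auto simp: tangent_chart_def)
  then show ?thesis
    using inv_into_f_f[OF inj_on_tangent_chart[OF assms(1,2)], of "(p, v)"] by (simp add: chart_inv_def)
qed

lemma in_loc_region:
  assumes "smooth_atlas A" "c \<in> A" "p \<in> fst c" "v \<in> tangent_space A p" "(p, v) \<in> \<Omega>"
  shows "(snd c p, v c) \<in> loc_region A c \<Omega>"
proof -
  have "(p, v) \<in> fst (tangent_chart A c)" "snd (tangent_chart A c) (p, v) = (snd c p, v c)"
    using assms by (auto simp: tangent_chart_def)
  then have "(snd c p, v c) \<in> snd (tangent_chart A c) ` fst (tangent_chart A c)"
    by (metis image_eqI)
  then show ?thesis
    using chart_inv_tangent_chart[OF assms(1-4)] assms(5) by (simp add: loc_region_def in_chart_def)
qed

lemma loc_regionE: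
  assumes "smooth_atlas A" "c \<in> A" "z \<in> loc_region A c \<Omega>"
  obtains p v where "z = (snd c p, v c)" "p \<in> fst c" "v \<in> tangent_space A p" "(p, v) \<in> \<Omega>"
proof -
  obtain p v where pv: "(p, v) \<in> fst (tangent_chart A c)" "z = snd (tangent_chart A c) (p, v)"
    using assms(3) by (auto simp: loc_region_def in_chart_def)
  then have "z = (snd c p, v c)" "p \<in> fst c" "v \<in> tangent_space A p"
    by (auto simp: tangent_chart_def)
  moreover from this have "(p, v) \<in> \<Omega>"
    using assms chart_inv_tangent_chart[of A c p v] by (auto simp: loc_region_def in_chart_def)
  ultimately show ?thesis by (rule that)
qed

lemma loc_fun_eq:
  assumes "smooth_atlas A" "c \<in> A" "p \<in> fst c" "v \<in> tangent_space A p"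
  shows "loc_fun A c f (snd c p, v c) = f (p, v)"
  using chart_inv_tangent_chart[OF assms] by (simp add: loc_fun_def)

lemma chart_inv_eq:
  assumes "smooth_atlas A" "c \<in> A" "p \<in> fst c"
  shows "chart_inv c (snd c p) = p"
  using assms by (auto simp: smooth_atlas_def chart_inv_def)

lemma in_chart_domain:
  assumes "smooth_atlas A" "c \<in> A" "p \<in> fst c" "p \<in> U"
  shows "snd c p \<in> in_chart c U"
  using assms chart_inv_eq[OF assms(1-3)] by (auto simp: in_chart_def)

lemma tangent_vector_nonzero:
  assumes "smooth_atlas A" "c \<in> A" "p \<in> fst c" "v \<in> tangent_space A p" "v \<noteq> (\<lambda>_. 0)"
  shows "v c \<noteq> 0"
proof
  assume "v c = 0"
  have "v d = 0" for d
  proof (cases "d \<in> A \<and> p \<in> fst d")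
    case True
    then have "transition c d differentiable (at (snd c p))"
      using assms in_chart_domain[OF assms(1-3), of "fst d"]
      by (auto simp: smooth_atlas_def intro!: smooth_on_imp_differentiable[of "in_chart c (fst d)"])
    then have "frechet_derivative (transition c d) (at (snd c p)) 0 = 0"
      by (intro linear_0 linear_frechet_derivative)
    then show ?thesis
      using tangent_space_transition[OF assms(4,2), of d] True assms(3) \<open>v c = 0\<close> by simp
  next
    case False
    then show ?thesis by (rule tangent_space_outside[OF assms(4)])
  qed
  then show False using assms by auto
qed

lemma conical_regionE:
  assumes "conical_region A \<Omega>" "w \<in> \<Omega>"
  obtains c where "c \<in> A" "fst w \<in> fst c" "snd w \<in> tangent_space A (fst w)"
proof -
  have "w \<in> carrier_of (tangent_atlas A)"
    using assms by (auto simp: conical_region_def openin_atlas_topology)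
  then show ?thesis
    using that by (auto simp: carrier_of_def tangent_atlas_def tangent_chart_def)
qed

lemma scaled_tangent:
  assumes "conical_region A \<Omega>" "(p, v) \<in> \<Omega>" "t > 0"
  shows "(p, \<lambda>c. t *\<^sub>R v c) \<in> \<Omega>" "(\<lambda>c. t *\<^sub>R v c) \<in> tangent_space A p"
proof -
  show in_\<Omega>: "(p, \<lambda>c. t *\<^sub>R v c) \<in> \<Omega>"
    using assms by (auto simp: conical_region_def scale_tangent_def dest!: bspec[of \<Omega> _ "(p, v)"])
  show "(\<lambda>c. t *\<^sub>R v c) \<in> tangent_space A p"
    using conical_regionE[OF assms(1) in_\<Omega>] by auto
qed

lemma cone_region_loc_region:
  fixes A :: "('m, real^'n::finite) chart set"
  assumes "smooth_atlas A" "conical_region A \<Omega>" "c \<in> A"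
  shows "cone_region (loc_region A c \<Omega>)"
proof
  show "open (loc_region A c \<Omega>)"
    using assms by (auto simp: conical_region_def openin_atlas_topology tangent_atlas_def loc_region_def)
next
  fix x y and t :: real assume "(x, y) \<in> loc_region A c \<Omega>" and t: "t > 0"
  then obtain p v where pv: "(x, y) = (snd c p, v c)" "p \<in> fst c" "v \<in> tangent_space A p" "(p, v) \<in> \<Omega>"
    using loc_regionE[OF assms(1,3)] by metis
  show "(x, t *\<^sub>R y) \<in> loc_region A c \<Omega>"
    using in_loc_region[OF assms(1,3) pv(2) scaled_tangent(2,1)[OF assms(2) pv(4) t]] pv(1) by simp
next
  fix x y assume "(x, y) \<in> loc_region A c \<Omega>"
  then obtain p v where pv: "(x, y) = (snd c p, v c)" "p \<in> fst c" "v \<in> tangent_space A p" "(p, v) \<in> \<Omega>"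
    using loc_regionE[OF assms(1,3)] by metis
  have "v \<noteq> (\<lambda>_. 0)" using pv(4) assms(2) by (auto simp: conical_region_def)
  then show "y \<noteq> 0" using tangent_vector_nonzero[OF assms(1,3) pv(2,3)] pv(1) by simp
qed

lemma pos_homogeneous_iff_local:
  fixes A :: "('m, real^'n::finite) chart set"
  assumes "smooth_atlas A" "conical_region A \<Omega>"
  shows "pos_homogeneous \<Omega> d f \<longleftrightarrow> (\<forall>c\<in>A. loc_pos_homogeneous (loc_region A c \<Omega>) d (loc_fun A c f))"
proof (intro iffI ballI)
  have scaled: "loc_fun A c f (snd c p, t *\<^sub>R v c) = f (scale_tangent t (p, v))"
    if "c \<in> A" "p \<in> fst c" "(p, v) \<in> \<Omega>" "t > 0" for c p v t
    using loc_fun_eq[OF assms(1) that(1,2) scaled_tangent(2)[OF assms(2) that(3,4)], of f]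
    by (simp add: scale_tangent_def)
  {
    fix c assume f: "pos_homogeneous \<Omega> d f" and c: "c \<in> A"
    show "loc_pos_homogeneous (loc_region A c \<Omega>) d (loc_fun A c f)"
      unfolding loc_pos_homogeneous_def
    proof clarify
      fix x y and t :: real assume "(x, y) \<in> loc_region A c \<Omega>" and t: "t > 0"
      then obtain p v where pv: "(x, y) = (snd c p, v c)" "p \<in> fst c" "v \<in> tangent_space A p" "(p, v) \<in> \<Omega>"
        using loc_regionE[OF assms(1) c] by metis
      show "loc_fun A c f (x, t *\<^sub>R y) = t ^ d *\<^sub>R loc_fun A c f (x, y)"
        using pv f t scaled[OF c pv(2,4) t] loc_fun_eq[OF assms(1) c pv(2,3), of f]
        by (auto simp: pos_homogeneous_def)
    qed
  next
    assume loc: "\<forall>c\<in>A. loc_pos_homogeneous (loc_region A c \<Omega>) d (loc_fun A c f)"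
    show "pos_homogeneous \<Omega> d f"
      unfolding pos_homogeneous_def
    proof (intro ballI allI impI)
      fix w and t :: real assume w: "w \<in> \<Omega>" and t: "t > 0"
      obtain p v where pv: "w = (p, v)" by (cases w)
      obtain c where c: "c \<in> A" "p \<in> fst c" "v \<in> tangent_space A p"
        using conical_regionE[OF assms(2) w] pv by auto
      have "(snd c p, v c) \<in> loc_region A c \<Omega>"
        using in_loc_region[OF assms(1) c] w pv by simp
      then have "loc_fun A c f (snd c p, t *\<^sub>R v c) = t ^ d * loc_fun A c f (snd c p, v c)"
        using loc c(1) t by (auto simp: loc_pos_homogeneous_def dest!: bspec)
      then show "f (scale_tangent t w) = t ^ d * f w"
        using w scaled[OF c(1,2) _ t, of v] loc_fun_eq[OF assms(1) c, of f]
        by (simp add: pv)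
    qed
  }
qed

lemma local_spray_spray_coeff:
  fixes A :: "('m, real^'n::finite) chart set"
  assumes "smooth_atlas A" "spray A \<Omega> G" "c \<in> A"
  shows "local_spray (loc_region A c \<Omega>) (spray_coeff A c G)"
proof -
  have "conical_region A \<Omega>" using assms by (simp add: spray_def)
  then interpret cone_region "loc_region A c \<Omega>"
    using cone_region_loc_region assms by blast
  show ?thesis
  proof
    fix i
    have "smooth_on (loc_region A c \<Omega>) (loc_field A c G)"
      using assms by (simp add: spray_def smooth_vector_field_def tangent_atlas_def loc_region_def loc_field_def[abs_def])
    moreover have "bounded_linear (\<lambda>w :: (real^'n) \<times> (real^'n). - (1/2) * (snd w $ i))"
      by (intro bounded_linear_const_mult bounded_linear_compose[OF bounded_linear_vec_nth bounded_linear_snd])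
    ultimately show "smooth_on (loc_region A c \<Omega>) (\<lambda>w. spray_coeff A c G w $ i)"
      using smooth_on_linear_compose[OF open_W, of "\<lambda>w. - (1/2) * (snd w $ i)" "loc_field A c G"]
      by (simp add: spray_coeff_def)
  next
    show "loc_pos_homogeneous (loc_region A c \<Omega>) 2 (spray_coeff A c G)"
      using assms by (simp add: spray_def)
  qed
qed

text \<open>The projective factor is smooth because \<open>y \<noteq> 0\<close> on the region: it is the quotient
  \<open>\<langle>Gbar - G, y\<rangle> / \<langle>y, y\<rangle>\<close>.\<close>

lemma projective_pair_charts:
  fixes A :: "('m, real^'n::finite) chart set"
  assumes "smooth_atlas A" "spray A \<Omega> G" "spray A \<Omega> Gbar" "projectively_related A \<Omega> Gbar G P" "c \<in> A"
  shows "projective_pair (loc_region A c \<Omega>) (spray_coeff A c G) (spray_coeff A c Gbar) (loc_fun A c P)"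
proof -
  let ?W = "loc_region A c \<Omega>" and ?P = "loc_fun A c P" and ?G = "spray_coeff A c G" and ?B = "spray_coeff A c Gbar"
  interpret G: local_spray ?W ?G by (rule local_spray_spray_coeff) fact+
  interpret B: local_spray ?W ?B by (rule local_spray_spray_coeff) fact+
  have eq: "?B z = ?G z + ?P z *\<^sub>R snd z" if "z \<in> ?W" for z
    using assms(4,5) that by (cases z) (auto simp: projectively_related_def)
  have nz: "(\<Sum>i\<in>UNIV. snd z $ i * snd z $ i) \<noteq> 0" if "z \<in> ?W" for z
    using G.nonzero_W[of "fst z" "snd z"] that
    by (auto simp: sum_nonneg_eq_0_iff vec_eq_iff)
  have "smooth_on ?W (\<lambda>z. (\<Sum>i\<in>UNIV. (?B z $ i - ?G z $ i) * snd z $ i) * inverse (\<Sum>i\<in>UNIV. snd z $ i * snd z $ i))"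
    by (intro G.smooth_intros smooth_on_inverse G.smooth_G B.smooth_G nz)
  moreover have "?P z = (\<Sum>i\<in>UNIV. (?B z $ i - ?G z $ i) * snd z $ i) * inverse (\<Sum>i\<in>UNIV. snd z $ i * snd z $ i)"
    if "z \<in> ?W" for z
    using nz[OF that] by (simp add: eq[OF that] mult.assoc sum_distrib_left[symmetric])
  ultimately have smooth: "smooth_on ?W ?P"
    using smooth_on_cong[OF G.open_W, of ?P] by simp
  have "conical_region A \<Omega>" using assms(2) by (simp add: spray_def)
  then have "loc_pos_homogeneous ?W (Suc 0) ?P"
    using assms(1,4,5) pos_homogeneous_iff_local[of A \<Omega> 1 P] by (simp add: projectively_related_def)
  with smooth eq B.local_spray_axioms show ?thesis by unfold_locales
qed

section \<open>The derivative of a function along a spray\<close>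

text \<open>The expression of a transition map of the tangent bundle in terms of a transition map \<open>\<phi>\<close> of
  the base.  Expanding \<open>y\<close> in a basis reduces its differentiability to that of the finitely many
  functions \<open>x \<mapsto> D\<phi>(x) b\<close>.\<close>

lemma differentiable_tangent_map:
  fixes \<phi> :: "'e::euclidean_space \<Rightarrow> 'f::real_normed_vector"
  assumes "open U" "smooth_on U \<phi>" "x \<in> U"
  shows "(\<lambda>z. (\<phi> (fst z), frechet_derivative \<phi> (at (fst z)) (snd z))) differentiable (at (x, y))"
proof -
  have fst: "(fst has_derivative fst) (at (x, y))"
    by (intro bounded_linear_imp_has_derivative bounded_linear_fst)
  have 1: "((\<lambda>z. \<phi> (fst z)) has_derivative (\<lambda>h. frechet_derivative \<phi> (at x) (fst h))) (at (x, y))"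
    using diff_chain_at[OF fst, of \<phi>] smooth_on_has_derivative[OF assms(2,3)]
    by (simp add: o_def)
  define D where "D b = frechet_derivative (\<lambda>x. frechet_derivative \<phi> (at x) b) (at x)" for b
  have D: "((\<lambda>z. frechet_derivative \<phi> (at (fst z)) b) has_derivative (\<lambda>h. D b (fst h))) (at (x, y))" for b
    using diff_chain_at[OF fst, of "\<lambda>x. frechet_derivative \<phi> (at x) b"]
      smooth_on_has_derivative[OF smooth_on_deriv[OF assms(2)] assms(3), of b]
    by (simp add: o_def D_def)
  have sum: "((\<lambda>z. \<Sum>b\<in>Basis. (snd z \<bullet> b) *\<^sub>R frechet_derivative \<phi> (at (fst z)) b) has_derivative
      (\<lambda>h. \<Sum>b\<in>Basis. (snd (x, y) \<bullet> b) *\<^sub>R D b (fst h) +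
        (snd h \<bullet> b) *\<^sub>R frechet_derivative \<phi> (at (fst (x, y))) b)) (at (x, y))"
    by (intro has_derivative_sum has_derivative_scaleR D has_derivative_inner_left has_derivative_snd has_derivative_ident)
  have expand: "(\<Sum>b\<in>Basis. (snd z \<bullet> b) *\<^sub>R frechet_derivative \<phi> (at (fst z)) b) = frechet_derivative \<phi> (at (fst z)) (snd z)"
    if "z \<in> U \<times> UNIV" for z
  proof -
    have lin: "linear (frechet_derivative \<phi> (at (fst z)))"
      using that assms(2) by (intro linear_frechet_derivative smooth_on_imp_differentiable[of U]) auto
    show ?thesis
      using linear_sum[OF lin, of "\<lambda>b. (snd z \<bullet> b) *\<^sub>R b" Basis]
      by (simp add: linear_scale[OF lin] euclidean_representation)
  qed
  have nbhd: "open (U \<times> (UNIV :: 'e set))" "(x, y) \<in> U \<times> UNIV"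
    using assms by (auto intro: open_Times)
  have 2: "((\<lambda>z. frechet_derivative \<phi> (at (fst z)) (snd z)) has_derivative
      (\<lambda>h. \<Sum>b\<in>Basis. (snd (x, y) \<bullet> b) *\<^sub>R D b (fst h) +
        (snd h \<bullet> b) *\<^sub>R frechet_derivative \<phi> (at (fst (x, y))) b)) (at (x, y))"
    by (rule has_derivative_transform_within_open[OF sum nbhd expand])
  show ?thesis
    using has_derivative_Pair[OF 1 2] unfolding differentiable_def by blast
qed

text \<open>The function \<open>G f\<close> on the region itself, evaluated in a chosen chart around the base
  point.  It provides \<open>P\<^sub>;\<^sub>0\<close> as a function on the tangent bundle, from which the scalar
  curvature of the new spray is built.\<close>

definition field_derivative ::
    "('m, 'e::euclidean_space) chart set \<Rightarrow> ('m, 'e) tangent_field \<Rightarrow>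
     (('m, 'e) tangent \<Rightarrow> real) \<Rightarrow> ('m, 'e) tangent \<Rightarrow> real" where
  "field_derivative A G f w =
     (let c = (SOME c. c \<in> A \<and> fst w \<in> fst c) in
      frechet_derivative (loc_fun A c f) (at (snd (tangent_chart A c) w))
        (G w (tangent_chart A c)))"

text \<open>The chain rule for \<open>f\<^sub>c = f\<^sub>d \<circ> \<Phi>\<close>, where the derivative of the transition map \<open>\<Phi>\<close> is what relates
  the components of \<open>X\<close> in the two charts.\<close>

lemma chart_derivative_independent:
  fixes A :: "('m, 'e::euclidean_space) chart set"
  assumes A: "smooth_atlas A" and c: "c \<in> A" "p \<in> fst c" and d: "d \<in> A" "p \<in> fst d"
    and v: "v \<in> tangent_space A p" "(p, v) \<in> \<Omega>"
    and open_W: "open (loc_region A c \<Omega>)"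
    and X: "X \<in> tangent_space (tangent_atlas A) (p, v)"
    and f: "loc_fun A d f differentiable (at (snd d p, v d))"
  shows "frechet_derivative (loc_fun A c f) (at (snd c p, v c)) (X (tangent_chart A c)) =
         frechet_derivative (loc_fun A d f) (at (snd d p, v d)) (X (tangent_chart A d))"
proof -
  define N where "N = loc_region A c \<Omega> \<inter> in_chart c (fst d) \<times> UNIV"
  define \<phi> where "\<phi> = transition c d"
  define \<Phi> where "\<Phi> = (\<lambda>z. (\<phi> (fst z), frechet_derivative \<phi> (at (fst z)) (snd z)))"
  have U: "open (in_chart c (fst d))" "smooth_on (in_chart c (fst d)) \<phi>"
    using A c d by (auto simp: smooth_atlas_def \<phi>_def)
  have N: "open N" "(snd c p, v c) \<in> N"
    using U open_W in_chart_domain[OF A c d(2)] in_loc_region[OF A c v]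
    by (auto simp: N_def intro!: open_Int open_Times)
  have on_N: "transition (tangent_chart A c) (tangent_chart A d) z = \<Phi> z"
      "loc_fun A c f z = loc_fun A d f (\<Phi> z)" if "z \<in> N" for z
  proof -
    from that have "z \<in> loc_region A c \<Omega>" by (simp add: N_def)
    then obtain q u where qu: "z = (snd c q, u c)" "q \<in> fst c" "u \<in> tangent_space A q" "(q, u) \<in> \<Omega>"
      using loc_regionE[OF A c(1)] by metis
    have q: "chart_inv c (snd c q) = q" by (rule chart_inv_eq[OF A c(1) qu(2)])
    have qd: "q \<in> fst d"
      using that q by (simp add: N_def qu(1) in_chart_def)
    have u: "u d = frechet_derivative \<phi> (at (snd c q)) (u c)"
      unfolding \<phi>_def by (rule tangent_space_transition[OF qu(3) c(1) d(1) qu(2) qd])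
    have \<Phi>: "\<Phi> z = (snd d q, u d)"
      using u q by (simp add: \<Phi>_def qu(1)) (simp add: \<phi>_def transition_def)
    show "transition (tangent_chart A c) (tangent_chart A d) z = \<Phi> z"
      unfolding transition_def \<Phi> using chart_inv_tangent_chart[OF A c(1) qu(2,3)]
      by (simp add: qu(1)) (simp add: tangent_chart_def)
    show "loc_fun A c f z = loc_fun A d f (\<Phi> z)"
      using loc_fun_eq[OF A c(1) qu(2,3), of f] loc_fun_eq[OF A d(1) qd qu(3), of f]
      by (simp only: \<Phi>) (simp add: qu(1))
  qed
  have \<Phi>_p: "\<Phi> (snd c p, v c) = (snd d p, v d)"
    using tangent_space_transition[OF v(1) c(1) d(1) c(2) d(2)] chart_inv_eq[OF A c]
    by (simp add: \<Phi>_def \<phi>_def) (simp add: transition_def)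
  let ?D = "frechet_derivative \<Phi> (at (snd c p, v c))"
  have \<Phi>: "(\<Phi> has_derivative ?D) (at (snd c p, v c))"
    using differentiable_tangent_map[OF U in_chart_domain[OF A c d(2)], of "v c"]
    by (simp add: \<Phi>_def frechet_derivative_works)
  have "((\<lambda>z. loc_fun A d f (\<Phi> z)) has_derivative
      (\<lambda>h. frechet_derivative (loc_fun A d f) (at (snd d p, v d)) (?D h))) (at (snd c p, v c))"
    using diff_chain_at[OF \<Phi>, of "loc_fun A d f"] f by (simp add: \<Phi>_p frechet_derivative_works o_def)
  then have "(loc_fun A c f has_derivative
      (\<lambda>h. frechet_derivative (loc_fun A d f) (at (snd d p, v d)) (?D h))) (at (snd c p, v c))"
    by (rule has_derivative_transform_within_open[OF _ N]) (simp add: on_N)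
  then have "frechet_derivative (loc_fun A c f) (at (snd c p, v c)) (X (tangent_chart A c)) =
      frechet_derivative (loc_fun A d f) (at (snd d p, v d)) (?D (X (tangent_chart A c)))"
    by (simp add: frechet_derivative_eqI)
  also have "?D (X (tangent_chart A c)) = X (tangent_chart A d)"
  proof -
    have "(transition (tangent_chart A c) (tangent_chart A d) has_derivative ?D) (at (snd c p, v c))"
      using \<Phi> by (rule has_derivative_transform_within_open[OF _ N]) (simp add: on_N)
    moreover have "X (tangent_chart A d) =
        frechet_derivative (transition (tangent_chart A c) (tangent_chart A d))
          (at (snd (tangent_chart A c) (p, v))) (X (tangent_chart A c))"
      using c d v(1) by (intro tangent_space_transition[OF X])
        (auto simp: tangent_atlas_def tangent_chart_def)
    ultimately show ?thesis by (simp add: frechet_derivative_eqI tangent_chart_def)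
  qed
  finally show ?thesis .
qed

lemma loc_fun_field_derivative:
  fixes A :: "('m, real^'n::finite) chart set"
  assumes A: "smooth_atlas A" and G: "spray A \<Omega> G"
    and f: "\<And>c. c \<in> A \<Longrightarrow> smooth_on (loc_region A c \<Omega>) (loc_fun A c f)"
    and c: "c \<in> A" "z \<in> loc_region A c \<Omega>"
  shows "loc_fun A c (field_derivative A G f) z = spray_derivative (spray_coeff A c G) (loc_fun A c f) z"
proof -
  obtain p v where pv: "z = (snd c p, v c)" "p \<in> fst c" "v \<in> tangent_space A p" "(p, v) \<in> \<Omega>"
    using loc_regionE[OF A c] .
  define d where "d = (SOME d. d \<in> A \<and> p \<in> fst d)"
  have d: "d \<in> A" "p \<in> fst d"
    using someI[of "\<lambda>d. d \<in> A \<and> p \<in> fst d" c] c(1) pv(2) unfolding d_def by blast+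
  have "conical_region A \<Omega>" using G by (simp add: spray_def)
  then have open_W: "open (loc_region A d \<Omega>)"
    using cone_region_loc_region[OF A _ d(1)] by (simp add: cone_region_def)
  have X: "G (p, v) \<in> tangent_space (tangent_atlas A) (p, v)"
    using G pv(4) by (simp add: spray_def smooth_vector_field_def)
  have "loc_fun A c (field_derivative A G f) z = field_derivative A G f (p, v)"
    unfolding pv(1) by (rule loc_fun_eq[OF A c(1) pv(2,3)])
  also have "\<dots> = frechet_derivative (loc_fun A d f) (at (snd d p, v d)) (G (p, v) (tangent_chart A d))"
    by (simp add: field_derivative_def d_def[symmetric] tangent_chart_def)
  also have "\<dots> = frechet_derivative (loc_fun A c f) (at z) (G (p, v) (tangent_chart A c))"
    unfolding pv(1)
    by (rule chart_derivative_independent[OF A d c(1) pv(2-4) open_W X])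
      (use smooth_on_imp_differentiable[OF f[OF c(1)] c(2)] pv(1) in simp)
  also have "G (p, v) (tangent_chart A c) = loc_field A c G z"
    using chart_inv_tangent_chart[OF A c(1) pv(2,3)] by (simp add: loc_field_def pv(1))
  also have "loc_field A c G z = (snd z, - 2 *\<^sub>R spray_coeff A c G z)"
  proof -
    have "fst (loc_field A c G z) = snd z"
      using G c by (cases z) (auto simp: spray_def)
    then show ?thesis by (simp add: prod_eq_iff spray_coeff_def)
  qed
  finally show ?thesis by (simp add: spray_derivative_def)
qed

section \<open>Isotropic curvature and Hamel functions\<close>

lemma isotropic_projective_imp_hamel:
  fixes A :: "('m, real^'n::finite) chart set"
  assumes A: "smooth_atlas A" and G: "spray A \<Omega> G" and Gbar: "spray A \<Omega> Gbar"
    and rel: "projectively_related A \<Omega> Gbar G P"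
    and iso: "isotropic_curvature A \<Omega> G" "isotropic_curvature A \<Omega> Gbar"
  shows "hamel_function A \<Omega> G P"
proof -
  obtain R \<tau> where R: "smooth_function (tangent_atlas A) \<Omega> R"
    "\<And>c z i k. c \<in> A \<Longrightarrow> z \<in> loc_region A c \<Omega> \<Longrightarrow> riemann (spray_coeff A c G) i k z =
       loc_fun A c R z * (if i = k then 1 else 0) - \<tau> c k z * snd z $ i"
    "\<And>c z k. c \<in> A \<Longrightarrow> z \<in> loc_region A c \<Omega> \<Longrightarrow> dy k (loc_fun A c R) z = 2 * \<tau> c k z"
    using iso(1) unfolding isotropic_curvature_def by blast
  obtain R' \<tau>' where R':
    "\<And>c z i k. c \<in> A \<Longrightarrow> z \<in> loc_region A c \<Omega> \<Longrightarrow> riemann (spray_coeff A c Gbar) i k z =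
       loc_fun A c R' z * (if i = k then 1 else 0) - \<tau>' c k z * snd z $ i"
    "\<And>c z k. c \<in> A \<Longrightarrow> z \<in> loc_region A c \<Omega> \<Longrightarrow> dy k (loc_fun A c R') z = 2 * \<tau>' c k z"
    using iso(2) unfolding isotropic_curvature_def by blast
  have "delta (spray_coeff A c G) k (loc_fun A c P) z = dot_hor_0 (spray_coeff A c G) k (loc_fun A c P) z"
    if c: "c \<in> A" and z: "z \<in> loc_region A c \<Omega>" for c z k
  proof -
    interpret projective_pair "loc_region A c \<Omega>" "spray_coeff A c G" "spray_coeff A c Gbar" "loc_fun A c P"
      by (rule projective_pair_charts[OF A G Gbar rel c])
    have "smooth_on (loc_region A c \<Omega>) (loc_fun A c R)"
      using R(1) c by (simp add: smooth_function_def tangent_atlas_def loc_region_def loc_fun_def)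
    then show ?thesis
      using isotropic_imp_hamel[OF R(2)[OF c] R'(1)[OF c] R(3)[OF c] R'(2)[OF c] _ z] by blast
  qed
  then show ?thesis
    using rel by (auto simp: hamel_function_def projectively_related_def)
qed

text \<open>The new scalar \<open>R + P\<^sup>2 - P\<^sub>;\<^sub>0\<close> has to be a single function on the region; this is where the
  chart independence of \<open>P\<^sub>;\<^sub>0\<close> is used.  The new covector is half of its vertical derivative.\<close>

lemma hamel_imp_isotropic:
  fixes A :: "('m, real^'n::finite) chart set"
  assumes A: "smooth_atlas A" and G: "spray A \<Omega> G" and Gbar: "spray A \<Omega> Gbar"
    and rel: "projectively_related A \<Omega> Gbar G P"
    and iso: "isotropic_curvature A \<Omega> G" and hamel: "hamel_function A \<Omega> G P"
  shows "isotropic_curvature A \<Omega> Gbar"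
proof -
  have cone: "conical_region A \<Omega>" using G by (simp add: spray_def)
  obtain R \<tau> where R: "smooth_function (tangent_atlas A) \<Omega> R" "pos_homogeneous \<Omega> 2 R"
    and \<tau>: "\<And>c k. c \<in> A \<Longrightarrow> smooth_on (loc_region A c \<Omega>) (\<tau> c k)"
      "\<And>c k. c \<in> A \<Longrightarrow> loc_pos_homogeneous (loc_region A c \<Omega>) 1 (\<tau> c k)"
    and riem: "\<And>c z i k. c \<in> A \<Longrightarrow> z \<in> loc_region A c \<Omega> \<Longrightarrow> riemann (spray_coeff A c G) i k z =
       loc_fun A c R z * (if i = k then 1 else 0) - \<tau> c k z * snd z $ i"
    and dR: "\<And>c z k. c \<in> A \<Longrightarrow> z \<in> loc_region A c \<Omega> \<Longrightarrow> dy k (loc_fun A c R) z = 2 * \<tau> c k z"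
    using iso unfolding isotropic_curvature_def by blast
  define \<xi> where "\<xi> c = projective_pair.xi (spray_coeff A c G) (loc_fun A c P)" for c
  define R' where "R' w = R w + ((P w)\<^sup>2 - field_derivative A G P w)" for w
  define \<tau>' where "\<tau>' c k z = \<tau> c k z + (1/2) * dy k (\<xi> c) z" for c k z
  have pair: "projective_pair (loc_region A c \<Omega>) (spray_coeff A c G) (spray_coeff A c Gbar) (loc_fun A c P)"
    if "c \<in> A" for c
    by (rule projective_pair_charts[OF A G Gbar rel that])
  have smooth_P: "smooth_on (loc_region A c \<Omega>) (loc_fun A c P)" if "c \<in> A" for c
    using projective_pair.smooth_P[OF pair[OF that]] .
  have R'_loc: "loc_fun A c R' z = loc_fun A c R z + \<xi> c z"
    if c: "c \<in> A" and z: "z \<in> loc_region A c \<Omega>" for c z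
    using loc_fun_field_derivative[OF A G smooth_P c z]
    unfolding \<xi>_def projective_pair.xi_def[OF pair[OF c]] by (simp add: loc_fun_def R'_def)
  have local: "smooth_on (loc_region A c \<Omega>) (loc_fun A c R') \<and>
      loc_pos_homogeneous (loc_region A c \<Omega>) 2 (loc_fun A c R') \<and>
      (\<forall>k. smooth_on (loc_region A c \<Omega>) (\<tau>' c k) \<and> loc_pos_homogeneous (loc_region A c \<Omega>) 1 (\<tau>' c k)) \<and>
      (\<forall>z\<in>loc_region A c \<Omega>. \<forall>i k. riemann (spray_coeff A c Gbar) i k z =
         loc_fun A c R' z * (if i = k then 1 else 0) - \<tau>' c k z * snd z $ i) \<and>
      (\<forall>z\<in>loc_region A c \<Omega>. \<forall>k. dy k (loc_fun A c R') z = 2 * \<tau>' c k z)"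
    if c: "c \<in> A" for c
  proof -
    let ?W = "loc_region A c \<Omega>"
    interpret projective_pair ?W "spray_coeff A c G" "spray_coeff A c Gbar" "loc_fun A c P"
      by (rule pair[OF c])
    have xi: "\<xi> c = xi" by (simp add: \<xi>_def)
    have smooth_R: "smooth_on ?W (loc_fun A c R)"
      using R(1) c by (simp add: smooth_function_def tangent_atlas_def loc_region_def loc_fun_def)
    have hom_R: "loc_pos_homogeneous ?W 2 (loc_fun A c R)"
      using R(2) pos_homogeneous_iff_local[OF A cone] c by blast
    have smooth_R': "smooth_on ?W (loc_fun A c R')"
      using smooth_on_cong[OF open_W R'_loc[OF c]] smooth_on_add[OF open_W smooth_R smooth_xi]
      by (simp add: xi)
    have hom_R': "loc_pos_homogeneous ?W 2 (loc_fun A c R')"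
      using homogeneousD[OF hom_R] homogeneousD[OF homogeneous_xi] cone_W
      by (intro homogeneousI) (simp add: R'_loc[OF c] xi distrib_left)
    have smooth_\<tau>': "smooth_on ?W (\<tau>' c k)" for k
      unfolding \<tau>'_def[abs_def] xi by (intro smooth_intros smooth_xi \<tau> c)
    have "loc_pos_homogeneous ?W 1 (dy k xi)" for k
      using homogeneous_dy[OF smooth_xi, of 1 k] homogeneous_xi by (simp add: numeral_2_eq_2)
    then have hom_\<tau>': "loc_pos_homogeneous ?W 1 (\<tau>' c k)" for k
      using homogeneousD[OF \<tau>(2)[OF c, of k]] homogeneousD[of 1 "dy k xi"]
      by (intro homogeneousI) (simp add: \<tau>'_def xi algebra_simps)
    have tau: "tau k z = - dy k xi z / 2" if "z \<in> ?W" for k z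
      using hamel c that by (intro hamel_imp_tau) (auto simp: hamel_function_def)
    have riem': "riemann (spray_coeff A c Gbar) i k z =
         loc_fun A c R' z * (if i = k then 1 else 0) - \<tau>' c k z * snd z $ i" if "z \<in> ?W" for z i k
      using that by (simp add: riemann_Gbar riem[OF c] R'_loc[OF c] xi tau \<tau>'_def algebra_simps)
    have "dy k (loc_fun A c R') z = 2 * \<tau>' c k z" if z: "z \<in> ?W" for z k
    proof -
      have "dy k (loc_fun A c R') z = dy k (\<lambda>w. loc_fun A c R w + xi w) z"
        by (rule dy_cong) (auto intro!: smooth_intros smooth_R smooth_xi z simp: R'_loc[OF c] xi)
      also have "\<dots> = dy k (loc_fun A c R) z + dy k xi z"
        unfolding dy_def by (intro derivative_add smooth_R smooth_xi z)
      finally show ?thesis using dR[OF c z] by (simp add: \<tau>'_def xi)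
    qed
    with smooth_R' hom_R' smooth_\<tau>' hom_\<tau>' riem' show ?thesis by blast
  qed
  have "smooth_function (tangent_atlas A) \<Omega> R'"
    using local by (simp add: smooth_function_def tangent_atlas_def loc_region_def loc_fun_def)
  moreover have "pos_homogeneous \<Omega> 2 R'"
    using local pos_homogeneous_iff_local[OF A cone] by blast
  ultimately show ?thesis
    unfolding isotropic_curvature_def using local by (intro exI[of _ R'] exI[of _ \<tau>']) simp
qed

theorem proposition4p4:
  fixes A :: "('m, real^'n::finite) chart set"
    and \<Omega> :: "('m, real^'n) tangent set"
    and G Gbar :: "('m, real^'n) tangent_field"
    and P :: "('m, real^'n) tangent \<Rightarrow> real"
  assumes "smooth_manifold A"
    and "spray A \<Omega> G"
    and "spray A \<Omega> Gbar"
    and "projectively_related A \<Omega> Gbar G P"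
  shows
    "(CARD('n) \<ge> 2 \<longrightarrow>
       ((\<forall>c\<in>A. \<forall>z\<in>loc_region A c \<Omega>. \<forall>i k.
           riemann (spray_coeff A c Gbar) i k z = riemann (spray_coeff A c G) i k z)
        \<longleftrightarrow> funk_function A \<Omega> G P)) \<and>
     (CARD('n) \<ge> 2 \<longrightarrow>
       ((\<forall>c\<in>A. \<forall>z\<in>loc_region A c \<Omega>.
           ricci (spray_coeff A c Gbar) z = ricci (spray_coeff A c G) z)
        \<longleftrightarrow> weak_funk_function A \<Omega> G P)) \<and>
     (isotropic_curvature A \<Omega> G \<longrightarrow>
       (isotropic_curvature A \<Omega> Gbar \<longleftrightarrow> hamel_function A \<Omega> G P))"
proof -
  have A: "smooth_atlas A" using assms(1) by (simp add: smooth_manifold_def)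
  have hom: "pos_homogeneous \<Omega> 1 P" using assms(4) by (simp add: projectively_related_def)
  note pair = projective_pair_charts[OF A assms(2-4)]
  have funk: "(\<forall>c\<in>A. \<forall>z\<in>loc_region A c \<Omega>. \<forall>i k.
      riemann (spray_coeff A c Gbar) i k z = riemann (spray_coeff A c G) i k z) \<longleftrightarrow> funk_function A \<Omega> G P"
    if "CARD('n) \<ge> 2"
    using projective_pair.riemann_eq_iff_funk[OF pair that] hom
    unfolding funk_function_def by simp
  have weak: "(\<forall>c\<in>A. \<forall>z\<in>loc_region A c \<Omega>.
      ricci (spray_coeff A c Gbar) z = ricci (spray_coeff A c G) z) \<longleftrightarrow> weak_funk_function A \<Omega> G P"
    if "CARD('n) \<ge> 2"
    using projective_pair.ricci_eq_iff_weak_funk[OF pair that] hom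
    unfolding weak_funk_function_def by simp
  show ?thesis
    using funk weak isotropic_projective_imp_hamel[OF A assms(2-4)] hamel_imp_isotropic[OF A assms(2-4)]
    by blast
qed

end
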